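(* Let $\mathcal M$ be a graded manifold and $\mathcal E$ a graded vector bundle over $\mathcal M$. Let $U\subseteq M$ be open and $F\in\mathrm{Loc}_{\mathcal E}(U)$. Then for any open $V\subseteq U$ there is a unique local operator $F|_V\in\mathrm{Loc}_{\mathcal E}(V)$ on $\mathcal E$ over $V$ such that $$F(\psi)|_V=F|_V(\psi|_V)$$ for all $\psi\in\Gamma_{\mathcal E}(U)$. There is a canonical graded $\mathcal C^\infty_{\mathcal M}(U)$-module structure on $\mathrm{Loc}_{\mathcal E}(U)$, given by $(f\cdot F)(\psi)=f\cdot F(\psi)$. With respect to the restriction maps $\mathrm{Loc}_{\mathcal E}(U)\to\mathrm{Loc}_{\mathcal E}(V)$, $F\mapsto F|_V$ (for open $V\subseteq U\subseteq M$), where $F|_V$ is the unique local operator on $\mathcal E$ over $V$ satisfying $F(\psi)|_V=F|_V(\psi|_V)$ for all $\psi\in\Gamma_{\mathcal E}(U)$, the assignment $U\mapsto\mathrm{Loc}_{\mathcal E}(U)$ makes $\mathrm{Loc}_{\mathcal E}$ into a sheaf of graded $\mathcal C^\infty_{\mathcal M}$-modules.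
   Context: Graded means $\mathbb{Z}$-graded. Graded vector spaces and modules are sequences indexed by $j\in\mathbb Z$; all elements are homogeneous and $|v|$ is the degree. A graded linear map $F$ of degree $|F|$ raises degree by $|F|$. Graded manifold $\mathcal M$: a second countable Hausdorff space $M$ with a sheaf $\mathcal{C}^\infty_{\mathcal M}$ of graded commutative associative unital real algebras, locally isomorphic to the following model: an open subset of $\mathbb R^{n_0}$ with the sheaf of formal power series in graded commuting variables of nonzero degrees ($n_j$ of degree $j\neq 0$), with smooth coefficients; $\sum_j n_j$ is finite. Graded vector bundle $\mathcal E$: a sheaf $\Gamma_{\mathcal E}$ of graded $\mathcal{C}^\infty_{\mathcal M}$-modules locally isomorphic to $\mathcal{C}^\infty_{\mathcal M}\otimes_{\mathbb R}K$ for a fixed finite-dimensional graded vector space $K$. Local operators: a graded $\mathbb R$-linear map $F:\Gamma_{\mathcal E}(U)\to\Gamma_{\mathcal E}(U)$ of any degree $|F|$ is a local operator on $\mathcal E$ over $U$ if for any open $V\subseteq U$ and any $\psi\in\Gamma_{\mathcal E}(U)$ with $\psi|_V=0$, one has $F(\psi)|_V=0$. Local operators on $\mathcal E$ over $U$ form a graded vector space $\mathrm{Loc}_{\mathcal E}(U)$. *)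

theory Defs
  imports
    "HOL-Analysis.Analysis"
    "HOL-Algebra.Algebraic_Closure_Type"
    "HOL-Library.Poly_Mapping"
begin

section \<open>Graded linear algebra\<close>

text \<open>
  A graded object is a sequence of real vector spaces indexed by the integers. Its elements are
  homogeneous: an element of degree \<open>k\<close> is an element of the carrier of the \<open>k\<close>-th part, and the
  degree is always passed as an explicit argument. The fields \<open>monoid.mult\<close> and \<open>one\<close>, which
  \<^type>\<open>module\<close> inherits from \<^type>\<open>ring\<close>, carry no meaning in a \<open>part\<close>.
\<close>

abbreviation real_field :: "real ring"
  where "real_field \<equiv> ring_of_type_algebra"

record 'v graded_space =
  part :: "int \<Rightarrow> (real, 'v) module"

record 'a graded_alg = "'a graded_space" +
  gmult :: "int \<Rightarrow> int \<Rightarrow> 'a \<Rightarrow> 'a \<Rightarrow> 'a"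
  gone :: 'a

record ('a, 'v) graded_mod = "'v graded_space" +
  gact :: "int \<Rightarrow> int \<Rightarrow> 'a \<Rightarrow> 'v \<Rightarrow> 'v"

abbreviation gcarrier :: "('v, 'z) graded_space_scheme \<Rightarrow> int \<Rightarrow> 'v set"
  where "gcarrier V k \<equiv> carrier (part V k)"

definition linear_maps :: "(real, 'v) module \<Rightarrow> (real, 'w) module \<Rightarrow> ('v \<Rightarrow> 'w) set"
  where "linear_maps M N =
    {f \<in> carrier M \<rightarrow> carrier N.
      (\<forall>x \<in> carrier M. \<forall>y \<in> carrier M. f (x \<oplus>\<^bsub>M\<^esub> y) = f x \<oplus>\<^bsub>N\<^esub> f y) \<and>
      (\<forall>c. \<forall>x \<in> carrier M. f (c \<odot>\<^bsub>M\<^esub> x) = c \<odot>\<^bsub>N\<^esub> f x)}"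

definition graded_linear ::
  "('v, 'y) graded_space_scheme \<Rightarrow> ('w, 'z) graded_space_scheme \<Rightarrow> int \<Rightarrow> (int \<Rightarrow> 'v \<Rightarrow> 'w) \<Rightarrow> bool"
  where "graded_linear V W d F \<longleftrightarrow> (\<forall>k. F k \<in> linear_maps (part V k) (part W (k + d)))"

locale graded_vector_space =
  fixes V :: "('v, 'z) graded_space_scheme"
  assumes part_module: "module real_field (part V k)"

definition finite_dimensional_graded :: "('v, 'z) graded_space_scheme \<Rightarrow> bool"
  where "finite_dimensional_graded V \<longleftrightarrow>
    (\<exists>B. finite B \<and> (\<forall>(j, b) \<in> B. b \<in> gcarrier V j) \<and>
      (\<forall>j. \<forall>v \<in> gcarrier V j. \<exists>c.
        v = finsum (part V j) (\<lambda>b. c b \<odot>\<^bsub>part V j\<^esub> b) {b. (j, b) \<in> B}))"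

locale graded_comm_algebra = graded_vector_space A
  for A :: "('a, 'z) graded_alg_scheme" +
  assumes gmult_linear_right:
      "a \<in> gcarrier A i \<Longrightarrow> gmult A i j a \<in> linear_maps (part A j) (part A (i + j))"
    and gmult_linear_left:
      "b \<in> gcarrier A j \<Longrightarrow> (\<lambda>a. gmult A i j a b) \<in> linear_maps (part A i) (part A (i + j))"
    and gmult_assoc:
      "\<lbrakk>a \<in> gcarrier A i; b \<in> gcarrier A j; c \<in> gcarrier A k\<rbrakk> \<Longrightarrow>
        gmult A (i + j) k (gmult A i j a b) c = gmult A i (j + k) a (gmult A j k b c)"
    and gone_closed: "gone A \<in> gcarrier A 0"
    and gone_left: "a \<in> gcarrier A i \<Longrightarrow> gmult A 0 i (gone A) a = a"
    and gone_right: "a \<in> gcarrier A i \<Longrightarrow> gmult A i 0 a (gone A) = a"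
    and gmult_comm:
      "\<lbrakk>a \<in> gcarrier A i; b \<in> gcarrier A j\<rbrakk> \<Longrightarrow>
        gmult A i j a b = (if odd i \<and> odd j then -1 else 1) \<odot>\<^bsub>part A (i + j)\<^esub> gmult A j i b a"

locale graded_module = A: graded_comm_algebra A + graded_vector_space V
  for A :: "('a, 'y) graded_alg_scheme" and V :: "('a, 'v, 'z) graded_mod_scheme" +
  assumes gact_linear_right:
      "f \<in> gcarrier A i \<Longrightarrow> gact V i j f \<in> linear_maps (part V j) (part V (i + j))"
    and gact_linear_left:
      "v \<in> gcarrier V j \<Longrightarrow> (\<lambda>f. gact V i j f v) \<in> linear_maps (part A i) (part V (i + j))"
    and gact_assoc:
      "\<lbrakk>f \<in> gcarrier A i; g \<in> gcarrier A j; v \<in> gcarrier V k\<rbrakk> \<Longrightarrow>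
        gact V (i + j) k (gmult A i j f g) v = gact V i (j + k) f (gact V j k g v)"
    and gact_one: "v \<in> gcarrier V k \<Longrightarrow> gact V 0 k (gone A) v = v"

definition graded_algebra_iso ::
  "('a, 'y) graded_alg_scheme \<Rightarrow> ('b, 'z) graded_alg_scheme \<Rightarrow> (int \<Rightarrow> 'a \<Rightarrow> 'b) \<Rightarrow> bool"
  where "graded_algebra_iso A B h \<longleftrightarrow>
    graded_linear A B 0 h \<and>
    (\<forall>k. bij_betw (h k) (gcarrier A k) (gcarrier B k)) \<and>
    (\<forall>i j. \<forall>a \<in> gcarrier A i. \<forall>b \<in> gcarrier A j.
      h (i + j) (gmult A i j a b) = gmult B i j (h i a) (h j b)) \<and>
    h 0 (gone A) = gone B"

definition graded_module_iso ::
  "('a, 'x) graded_alg_scheme \<Rightarrow> ('a, 'v, 'y) graded_mod_scheme \<Rightarrow> ('a, 'w, 'z) graded_mod_scheme \<Rightarrow>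
    (int \<Rightarrow> 'v \<Rightarrow> 'w) \<Rightarrow> bool"
  where "graded_module_iso A V W h \<longleftrightarrow>
    graded_linear V W 0 h \<and>
    (\<forall>k. bij_betw (h k) (gcarrier V k) (gcarrier W k)) \<and>
    (\<forall>i k. \<forall>f \<in> gcarrier A i. \<forall>v \<in> gcarrier V k. h (i + k) (gact V i k f v) = gact W i k f (h k v))"


section \<open>The graded module \<open>A \<otimes> K\<close>\<close>

text \<open>
  The part of \<open>A \<otimes> K\<close> (tensor product over the reals) in degree \<open>k\<close> is the sum over \<open>i\<close> of the
  spaces \<open>A\<^sub>i \<otimes> K\<^bsub>k-i\<^esub>\<close>: the quotient of the free real vector space on the triples \<open>(i, a, w)\<close>, which
  represent \<open>a \<otimes> w\<close> with \<open>a\<close> of degree \<open>i\<close> and \<open>w\<close> of degree \<open>k - i\<close>, by the span of the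
  bilinearity relations.
\<close>

type_synonym ('a, 'k) tensor_vec = "(int \<times> 'a \<times> 'k) \<Rightarrow>\<^sub>0 real"

definition tensor_gens ::
  "('a, 'y) graded_space_scheme \<Rightarrow> ('k, 'z) graded_space_scheme \<Rightarrow> int \<Rightarrow> (int \<times> 'a \<times> 'k) set"
  where "tensor_gens A K k = {(i, a, w). a \<in> gcarrier A i \<and> w \<in> gcarrier K (k - i)}"

inductive_set tensor_rel ::
  "('a, 'y) graded_space_scheme \<Rightarrow> ('k, 'z) graded_space_scheme \<Rightarrow> int \<Rightarrow> ('a, 'k) tensor_vec set"
  for A :: "('a, 'y) graded_space_scheme" and K :: "('k, 'z) graded_space_scheme" and k :: int
  where
    add_left: "\<lbrakk>a \<in> gcarrier A i; b \<in> gcarrier A i; w \<in> gcarrier K (k - i)\<rbrakk> \<Longrightarrow>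
      Poly_Mapping.single (i, a \<oplus>\<^bsub>part A i\<^esub> b, w) 1
        - Poly_Mapping.single (i, a, w) 1 - Poly_Mapping.single (i, b, w) 1 \<in> tensor_rel A K k"
  | add_right: "\<lbrakk>a \<in> gcarrier A i; v \<in> gcarrier K (k - i); w \<in> gcarrier K (k - i)\<rbrakk> \<Longrightarrow>
      Poly_Mapping.single (i, a, v \<oplus>\<^bsub>part K (k - i)\<^esub> w) 1
        - Poly_Mapping.single (i, a, v) 1 - Poly_Mapping.single (i, a, w) 1 \<in> tensor_rel A K k"
  | smult_left: "\<lbrakk>a \<in> gcarrier A i; w \<in> gcarrier K (k - i)\<rbrakk> \<Longrightarrow>
      Poly_Mapping.single (i, c \<odot>\<^bsub>part A i\<^esub> a, w) 1 - Poly_Mapping.single (i, a, w) c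
        \<in> tensor_rel A K k"
  | smult_right: "\<lbrakk>a \<in> gcarrier A i; w \<in> gcarrier K (k - i)\<rbrakk> \<Longrightarrow>
      Poly_Mapping.single (i, a, c \<odot>\<^bsub>part K (k - i)\<^esub> w) 1 - Poly_Mapping.single (i, a, w) c
        \<in> tensor_rel A K k"
  | span_zero: "0 \<in> tensor_rel A K k"
  | span_add: "\<lbrakk>p \<in> tensor_rel A K k; q \<in> tensor_rel A K k\<rbrakk> \<Longrightarrow> p + q \<in> tensor_rel A K k"
  | span_smult: "p \<in> tensor_rel A K k \<Longrightarrow> Poly_Mapping.map ((*) c) p \<in> tensor_rel A K k"

definition tensor_class ::
  "('a, 'y) graded_space_scheme \<Rightarrow> ('k, 'z) graded_space_scheme \<Rightarrow> int \<Rightarrow>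
    ('a, 'k) tensor_vec \<Rightarrow> ('a, 'k) tensor_vec set"
  where "tensor_class A K k p =
    {q. Poly_Mapping.keys q \<subseteq> tensor_gens A K k \<and> q - p \<in> tensor_rel A K k}"

text \<open>The linear extension of a map between generators, on the free vector spaces.\<close>

definition free_extend :: "('x \<Rightarrow> 'y) \<Rightarrow> ('x \<Rightarrow>\<^sub>0 real) \<Rightarrow> ('y \<Rightarrow>\<^sub>0 real)"
  where "free_extend \<theta> p =
    (\<Sum>x \<in> Poly_Mapping.keys p. Poly_Mapping.single (\<theta> x) (Poly_Mapping.lookup p x))"

text \<open>
  Operations on classes are given as the union of the classes of the results on all
  representatives; this union is a single class because the operation respects the relations.
\<close>

definition tensor_module ::
  "('a, 'y) graded_alg_scheme \<Rightarrow> ('k, 'z) graded_space_scheme \<Rightarrow> ('a, ('a, 'k) tensor_vec set) graded_mod"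
  where "tensor_module A K =
    \<lparr> part = (\<lambda>k.
        \<lparr> carrier = tensor_class A K k ` {p. Poly_Mapping.keys p \<subseteq> tensor_gens A K k},
          monoid.mult = undefined, one = undefined,
          zero = tensor_class A K k 0,
          add = (\<lambda>s t. \<Union>p \<in> s. \<Union>q \<in> t. tensor_class A K k (p + q)),
          smult = (\<lambda>c s. \<Union>p \<in> s. tensor_class A K k (Poly_Mapping.map ((*) c) p)) \<rparr>),
      gact = (\<lambda>l k f s. \<Union>p \<in> s.
        tensor_class A K (l + k) (free_extend (\<lambda>(i, a, w). (l + i, gmult A l i f a, w)) p)) \<rparr>"

text \<open>The map \<open>\<eta> \<otimes> id\<close> from \<open>A \<otimes> K\<close> to \<open>B \<otimes> K\<close> induced by a degree zero map \<open>\<eta>\<close> from \<open>A\<close> to \<open>B\<close>.\<close>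

definition tensor_map ::
  "('b, 'y) graded_space_scheme \<Rightarrow> ('k, 'z) graded_space_scheme \<Rightarrow> (int \<Rightarrow> 'a \<Rightarrow> 'b) \<Rightarrow>
    int \<Rightarrow> ('a, 'k) tensor_vec set \<Rightarrow> ('b, 'k) tensor_vec set"
  where "tensor_map B K \<eta> k s =
    (\<Union>p \<in> s. tensor_class B K k (free_extend (\<lambda>(i, a, w). (i, \<eta> i a, w)) p))"


section \<open>Sheaves of graded objects\<close>

text \<open>
  \<open>\<rho> U V\<close> is the restriction from \<open>U\<close> to \<open>V\<close>; it is only meaningful for open \<open>V \<subseteq> U\<close>. The cover in
  the gluing axiom may be empty, so there is exactly one section over the empty set in each degree.
\<close>

locale graded_sheaf =
  fixes M :: "'p topology"
    and G :: "'p set \<Rightarrow> ('v, 'z) graded_space_scheme"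
    and \<rho> :: "'p set \<Rightarrow> 'p set \<Rightarrow> int \<Rightarrow> 'v \<Rightarrow> 'v"
  assumes sections: "openin M U \<Longrightarrow> graded_vector_space (G U)"
    and res_linear: "\<lbrakk>openin M U; openin M V; V \<subseteq> U\<rbrakk> \<Longrightarrow> graded_linear (G U) (G V) 0 (\<rho> U V)"
    and res_id: "\<lbrakk>openin M U; s \<in> gcarrier (G U) k\<rbrakk> \<Longrightarrow> \<rho> U U k s = s"
    and res_comp:
      "\<lbrakk>openin M U; openin M V; openin M W; W \<subseteq> V; V \<subseteq> U; s \<in> gcarrier (G U) k\<rbrakk> \<Longrightarrow>
        \<rho> V W k (\<rho> U V k s) = \<rho> U W k s"
    and gluing:
      "\<lbrakk>\<And>V. V \<in> \<U> \<Longrightarrow> openin M V;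
        \<And>V. V \<in> \<U> \<Longrightarrow> t V \<in> gcarrier (G V) k;
        \<And>V W. \<lbrakk>V \<in> \<U>; W \<in> \<U>\<rbrakk> \<Longrightarrow> \<rho> V (V \<inter> W) k (t V) = \<rho> W (V \<inter> W) k (t W)\<rbrakk> \<Longrightarrow>
        \<exists>!s. s \<in> gcarrier (G (\<Union>\<U>)) k \<and> (\<forall>V \<in> \<U>. \<rho> (\<Union>\<U>) V k s = t V)"

locale sheaf_of_graded_algebras = graded_sheaf M C \<rho>
  for M :: "'p topology"
    and C :: "'p set \<Rightarrow> ('c, 'z) graded_alg_scheme"
    and \<rho> :: "'p set \<Rightarrow> 'p set \<Rightarrow> int \<Rightarrow> 'c \<Rightarrow> 'c" +
  assumes algebras: "openin M U \<Longrightarrow> graded_comm_algebra (C U)"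
    and res_gmult:
      "\<lbrakk>openin M U; openin M V; V \<subseteq> U; f \<in> gcarrier (C U) i; g \<in> gcarrier (C U) j\<rbrakk> \<Longrightarrow>
        \<rho> U V (i + j) (gmult (C U) i j f g) = gmult (C V) i j (\<rho> U V i f) (\<rho> U V j g)"
    and res_gone: "\<lbrakk>openin M U; openin M V; V \<subseteq> U\<rbrakk> \<Longrightarrow> \<rho> U V 0 (gone (C U)) = gone (C V)"

locale sheaf_of_graded_modules =
  C: sheaf_of_graded_algebras M C \<rho> + graded_sheaf M E \<sigma>
  for M :: "'p topology"
    and C :: "'p set \<Rightarrow> ('c, 'y) graded_alg_scheme"
    and \<rho> :: "'p set \<Rightarrow> 'p set \<Rightarrow> int \<Rightarrow> 'c \<Rightarrow> 'c"
    and E :: "'p set \<Rightarrow> ('c, 'e, 'z) graded_mod_scheme"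
    and \<sigma> :: "'p set \<Rightarrow> 'p set \<Rightarrow> int \<Rightarrow> 'e \<Rightarrow> 'e" +
  assumes modules: "openin M U \<Longrightarrow> graded_module (C U) (E U)"
    and res_gact:
      "\<lbrakk>openin M U; openin M V; V \<subseteq> U; f \<in> gcarrier (C U) i; s \<in> gcarrier (E U) k\<rbrakk> \<Longrightarrow>
        \<sigma> U V (i + k) (gact (E U) i k f s) = gact (E V) i k (\<rho> U V i f) (\<sigma> U V k s)"


section \<open>Graded manifolds\<close>

text \<open>
  A point of \<open>\<real>\<^sup>m\<close> is a function on the naturals vanishing from \<open>m\<close> on, as in
  \<^const>\<open>Euclidean_space\<close>. \<open>C_diff m k U f\<close> says that \<open>f\<close> is \<open>k\<close> times continuously differentiable
  on the open subset \<open>U\<close> of \<open>\<real>\<^sup>m\<close>: the iterated partial derivatives up to order \<open>k\<close> exist and are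
  continuous.
\<close>

fun C_diff :: "nat \<Rightarrow> nat \<Rightarrow> (nat \<Rightarrow> real) set \<Rightarrow> ((nat \<Rightarrow> real) \<Rightarrow> real) \<Rightarrow> bool"
  where
    "C_diff m 0 U f \<longleftrightarrow> continuous_map (subtopology (Euclidean_space m) U) euclideanreal f"
  | "C_diff m (Suc k) U f \<longleftrightarrow>
      continuous_map (subtopology (Euclidean_space m) U) euclideanreal f \<and>
      (\<forall>i<m. \<exists>g. (\<forall>x\<in>U. ((\<lambda>t. f (x(i := t))) has_real_derivative g x) (at (x i))) \<and> C_diff m k U g)"

definition smooth_on :: "nat \<Rightarrow> (nat \<Rightarrow> real) set \<Rightarrow> ((nat \<Rightarrow> real) \<Rightarrow> real) \<Rightarrow> bool"
  where "smooth_on m U f \<longleftrightarrow> (\<forall>k. C_diff m k U f)"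

text \<open>
  Let \<open>n j\<close> be the number of coordinates of degree \<open>j\<close>. The graded variables \<open>\<xi>\<close> are indexed by the
  pairs \<open>(j, m)\<close> with \<open>j \<noteq> 0\<close> and \<open>m < n j\<close>, ordered lexicographically; the variable \<open>(j, m)\<close> has
  degree \<open>j\<close>. A monomial \<open>\<xi>\<^sup>p\<close> is the product in increasing order of the powers of the variables,
  where the exponents of the variables of odd degree are at most one.
\<close>

definition graded_vars :: "(int \<Rightarrow> nat) \<Rightarrow> (int \<times> nat) set"
  where "graded_vars n = {(j, m). j \<noteq> 0 \<and> m < n j}"

definition multi_indices :: "(int \<Rightarrow> nat) \<Rightarrow> int \<Rightarrow> (int \<times> nat \<Rightarrow> nat) set"
  where "multi_indices n k =
    {p. (\<forall>a. a \<notin> graded_vars n \<longrightarrow> p a = 0) \<and>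
        (\<forall>a \<in> graded_vars n. odd (fst a) \<longrightarrow> p a \<le> 1) \<and>
        (\<Sum>a \<in> graded_vars n. int (p a) * fst a) = k}"

text \<open>
  The sign in \<open>\<xi>\<^sup>p \<xi>\<^sup>q = \<plusminus>\<xi>\<^bsup>p+q\<^esup>\<close>: every odd variable \<open>a\<close> of \<open>\<xi>\<^sup>p\<close> has to be moved past every smaller
  odd variable \<open>b\<close> of \<open>\<xi>\<^sup>q\<close>.
\<close>

definition monomial_sign ::
  "(int \<Rightarrow> nat) \<Rightarrow> (int \<times> nat \<Rightarrow> nat) \<Rightarrow> (int \<times> nat \<Rightarrow> nat) \<Rightarrow> real"
  where "monomial_sign n p q = (-1) ^ card
    {(a, b). a \<in> graded_vars n \<and> b \<in> graded_vars n \<and> odd (fst a) \<and> odd (fst b) \<and>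
      (fst b < fst a \<or> fst b = fst a \<and> snd b < snd a) \<and> p a = 1 \<and> q b = 1}"

text \<open>
  The graded algebra over an open subset \<open>U\<close> of \<open>\<real>\<^sup>m\<close>, where \<open>m = n 0\<close>. A formal power series
  \<open>f = \<Sum>p. f\<^sub>p \<xi>\<^sup>p\<close> of degree \<open>k\<close> is represented by its family of coefficients. These are set to zero
  when \<open>p\<close> is not a multi-index of degree \<open>k\<close>, and at points outside \<open>U\<close>, so that distinct
  representatives are distinct series.
\<close>

definition model_algebra ::
  "(int \<Rightarrow> nat) \<Rightarrow> (nat \<Rightarrow> real) set \<Rightarrow> ((int \<times> nat \<Rightarrow> nat) \<Rightarrow> (nat \<Rightarrow> real) \<Rightarrow> real) graded_alg"
  where "model_algebra n U =
    \<lparr> part = (\<lambda>k.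
        \<lparr> carrier = {f. (\<forall>p \<in> multi_indices n k. smooth_on (n 0) U (f p)) \<and>
                       (\<forall>p x. p \<notin> multi_indices n k \<or> x \<notin> U \<longrightarrow> f p x = 0)},
          monoid.mult = undefined, one = undefined,
          zero = (\<lambda>p x. 0),
          add = (\<lambda>f g p x. f p x + g p x),
          smult = (\<lambda>c f p x. c * f p x) \<rparr>),
      gmult = (\<lambda>i j f g r x.
        if r \<in> multi_indices n (i + j)
        then \<Sum>(p, q) \<in> {(p, q). p \<in> multi_indices n i \<and> q \<in> multi_indices n j \<and> r = (\<lambda>a. p a + q a)}.
               monomial_sign n p q * f p x * g q x
        else 0),
      gone = (\<lambda>p x. if p = (\<lambda>a. 0) \<and> x \<in> U then 1 else 0) \<rparr>"

definition model_res ::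
  "(nat \<Rightarrow> real) set \<Rightarrow> ('i \<Rightarrow> (nat \<Rightarrow> real) \<Rightarrow> real) \<Rightarrow> 'i \<Rightarrow> (nat \<Rightarrow> real) \<Rightarrow> real"
  where "model_res V f = (\<lambda>p x. if x \<in> V then f p x else 0)"

text \<open>
  A chart: a homeomorphism \<open>\<phi>\<close> from the open set \<open>W\<close> onto an open subset of Euclidean space,
  together with an isomorphism of sheaves of graded algebras over it.
\<close>

definition graded_chart ::
  "(int \<Rightarrow> nat) \<Rightarrow> 'p topology \<Rightarrow> ('p set \<Rightarrow> ('c, 'z) graded_alg_scheme) \<Rightarrow>
    ('p set \<Rightarrow> 'p set \<Rightarrow> int \<Rightarrow> 'c \<Rightarrow> 'c) \<Rightarrow> 'p set \<Rightarrow> ('p \<Rightarrow> nat \<Rightarrow> real) \<Rightarrow>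
    ('p set \<Rightarrow> int \<Rightarrow> 'c \<Rightarrow> (int \<times> nat \<Rightarrow> nat) \<Rightarrow> (nat \<Rightarrow> real) \<Rightarrow> real) \<Rightarrow> bool"
  where "graded_chart n M C \<rho> W \<phi> h \<longleftrightarrow>
    openin M W \<and>
    openin (Euclidean_space (n 0)) (\<phi> ` W) \<and>
    homeomorphic_map (subtopology M W) (subtopology (Euclidean_space (n 0)) (\<phi> ` W)) \<phi> \<and>
    (\<forall>U. openin M U \<and> U \<subseteq> W \<longrightarrow> graded_algebra_iso (C U) (model_algebra n (\<phi> ` U)) (h U)) \<and>
    (\<forall>U V k. \<forall>f \<in> gcarrier (C U) k. openin M U \<and> openin M V \<and> V \<subseteq> U \<and> U \<subseteq> W \<longrightarrow>
      h V k (\<rho> U V k f) = model_res (\<phi> ` V) (h U k f))"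

locale graded_manifold = sheaf_of_graded_algebras M C \<rho>
  for n :: "int \<Rightarrow> nat"
    and M :: "'p topology"
    and C :: "'p set \<Rightarrow> ('c, 'z) graded_alg_scheme"
    and \<rho> :: "'p set \<Rightarrow> 'p set \<Rightarrow> int \<Rightarrow> 'c \<Rightarrow> 'c" +
  assumes hausdorff: "Hausdorff_space M"
    and second_countable: "second_countable M"
    and finite_dimension: "finite {j. n j \<noteq> 0}"
    and charts: "x \<in> topspace M \<Longrightarrow> \<exists>W \<phi> h. x \<in> W \<and> graded_chart n M C \<rho> W \<phi> h"


section \<open>Graded vector bundles\<close>

definition local_trivialization ::
  "'p topology \<Rightarrow> ('p set \<Rightarrow> ('c, 'x) graded_alg_scheme) \<Rightarrow> ('p set \<Rightarrow> 'p set \<Rightarrow> int \<Rightarrow> 'c \<Rightarrow> 'c) \<Rightarrow>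
    ('k, 'y) graded_space_scheme \<Rightarrow> ('p set \<Rightarrow> ('c, 'e, 'z) graded_mod_scheme) \<Rightarrow>
    ('p set \<Rightarrow> 'p set \<Rightarrow> int \<Rightarrow> 'e \<Rightarrow> 'e) \<Rightarrow> 'p set \<Rightarrow>
    ('p set \<Rightarrow> int \<Rightarrow> 'e \<Rightarrow> ('c, 'k) tensor_vec set) \<Rightarrow> bool"
  where "local_trivialization M C \<rho> K E \<sigma> W h \<longleftrightarrow>
    openin M W \<and>
    (\<forall>U. openin M U \<and> U \<subseteq> W \<longrightarrow> graded_module_iso (C U) (E U) (tensor_module (C U) K) (h U)) \<and>
    (\<forall>U V k. \<forall>s \<in> gcarrier (E U) k. openin M U \<and> openin M V \<and> V \<subseteq> U \<and> U \<subseteq> W \<longrightarrow>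
      h V k (\<sigma> U V k s) = tensor_map (C V) K (\<rho> U V) k (h U k s))"

locale graded_vector_bundle = sheaf_of_graded_modules M C \<rho> E \<sigma> + fiber: graded_vector_space K
  for M :: "'p topology"
    and C :: "'p set \<Rightarrow> ('c, 'x) graded_alg_scheme"
    and \<rho> :: "'p set \<Rightarrow> 'p set \<Rightarrow> int \<Rightarrow> 'c \<Rightarrow> 'c"
    and K :: "('k, 'y) graded_space_scheme"
    and E :: "'p set \<Rightarrow> ('c, 'e, 'z) graded_mod_scheme"
    and \<sigma> :: "'p set \<Rightarrow> 'p set \<Rightarrow> int \<Rightarrow> 'e \<Rightarrow> 'e" +
  assumes fiber_finite_dimensional: "finite_dimensional_graded K"
    and locally_trivial:
      "x \<in> topspace M \<Longrightarrow> \<exists>W h. x \<in> W \<and> local_trivialization M C \<rho> K E \<sigma> W h"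


section \<open>Local operators\<close>

text \<open>
  Local operators are taken to be \<^const>\<open>undefined\<close> outside the carriers on which they act, so that
  equality of local operators is equality of their values on sections.
\<close>

definition local_operators ::
  "'p topology \<Rightarrow> ('p set \<Rightarrow> ('e, 'z) graded_space_scheme) \<Rightarrow>
    ('p set \<Rightarrow> 'p set \<Rightarrow> int \<Rightarrow> 'e \<Rightarrow> 'e) \<Rightarrow> 'p set \<Rightarrow> int \<Rightarrow> (int \<Rightarrow> 'e \<Rightarrow> 'e) set"
  where "local_operators M E \<sigma> U d =
    {F. graded_linear (E U) (E U) d F \<and>
        (\<forall>k. F k \<in> extensional (gcarrier (E U) k)) \<and>
        (\<forall>V k. \<forall>\<psi> \<in> gcarrier (E U) k. openin M V \<and> V \<subseteq> U \<and> \<sigma> U V k \<psi> = \<zero>\<^bsub>part (E V) k\<^esub> \<longrightarrow>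
          \<sigma> U V (k + d) (F k \<psi>) = \<zero>\<^bsub>part (E V) (k + d)\<^esub>)}"

definition Loc ::
  "'p topology \<Rightarrow> ('p set \<Rightarrow> ('c, 'e, 'z) graded_mod_scheme) \<Rightarrow>
    ('p set \<Rightarrow> 'p set \<Rightarrow> int \<Rightarrow> 'e \<Rightarrow> 'e) \<Rightarrow> 'p set \<Rightarrow> ('c, int \<Rightarrow> 'e \<Rightarrow> 'e) graded_mod"
  where "Loc M E \<sigma> U =
    \<lparr> part = (\<lambda>d.
        \<lparr> carrier = local_operators M E \<sigma> U d,
          monoid.mult = undefined, one = undefined,
          zero = (\<lambda>k. \<lambda>\<psi> \<in> gcarrier (E U) k. \<zero>\<^bsub>part (E U) (k + d)\<^esub>),
          add = (\<lambda>F G k. \<lambda>\<psi> \<in> gcarrier (E U) k. F k \<psi> \<oplus>\<^bsub>part (E U) (k + d)\<^esub> G k \<psi>),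
          smult = (\<lambda>c F k. \<lambda>\<psi> \<in> gcarrier (E U) k. c \<odot>\<^bsub>part (E U) (k + d)\<^esub> F k \<psi>) \<rparr>),
      gact = (\<lambda>i d f F k. \<lambda>\<psi> \<in> gcarrier (E U) k. gact (E U) i (k + d) f (F k \<psi>)) \<rparr>"

definition loc_res ::
  "'p topology \<Rightarrow> ('p set \<Rightarrow> ('c, 'e, 'z) graded_mod_scheme) \<Rightarrow>
    ('p set \<Rightarrow> 'p set \<Rightarrow> int \<Rightarrow> 'e \<Rightarrow> 'e) \<Rightarrow> 'p set \<Rightarrow> 'p set \<Rightarrow> int \<Rightarrow> (int \<Rightarrow> 'e \<Rightarrow> 'e) \<Rightarrow> int \<Rightarrow> 'e \<Rightarrow> 'e"
  where "loc_res M E \<sigma> U V d F =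
    (THE G. G \<in> gcarrier (Loc M E \<sigma> V) d \<and>
      (\<forall>k. \<forall>\<psi> \<in> gcarrier (E U) k. \<sigma> U V (k + d) (F k \<psi>) = G k (\<sigma> U V k \<psi>)))"

end

theory Submission
  imports Defs
begin

text \<open>
  The point is that sections can be extended up to shrinking: if \<open>\<psi>\<close> is a section over \<open>V \<subseteq> U\<close> and
  \<open>x \<in> V\<close>, then some section over \<open>U\<close> agrees with \<open>\<psi>\<close> near \<open>x\<close> (\<open>extend_germ\<close>). For this, \<open>\<psi>\<close> is
  multiplied by a function of degree zero that is the unit near \<open>x\<close> and vanishes off a closed subset of
  \<open>V\<close>, and the product is glued with zero. Such functions exist on a graded manifold
  (\<open>bump_function\<close>): in a chart one takes a smooth bump function of compact support on Euclidean space
  (\<open>Euclidean_bump\<close>), as a power series without graded variables, and extends it by zero.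

  A local operator \<open>F\<close> over \<open>U\<close> maps sections that agree over an open subset to sections that agree
  there (\<open>Loc_res_cong\<close>). Hence a local operator \<open>G\<close> over \<open>V\<close> with \<open>F(\<phi>)|\<^sub>V = G(\<phi>|\<^sub>V)\<close> is determined near
  \<open>x\<close> by \<open>G(\<psi>) = F(\<phi>)\<close> for any \<open>\<phi>\<close> over \<open>U\<close> that agrees with \<open>\<psi>\<close> near \<open>x\<close>, which shows
  uniqueness; conversely, these local values do not depend on \<open>\<phi>\<close> and glue to a section \<open>G(\<psi>)\<close>.
  Linearity and locality of \<open>G\<close> can be checked near each point (\<open>restriction_exists\<close>).

  The module structure is pointwise. The presheaf axioms and the compatibility of restriction with
  all operations follow from the uniqueness of \<open>F|\<^sub>V\<close>, and local operators that agree on overlaps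
  are glued by gluing their values (\<open>Loc_gluing\<close>).
\<close>


section \<open>Graded linear algebra\<close>

lemma linear_mapsD:
  assumes "f \<in> linear_maps M N"
  shows "x \<in> carrier M \<Longrightarrow> f x \<in> carrier N"
    and "\<lbrakk>x \<in> carrier M; y \<in> carrier M\<rbrakk> \<Longrightarrow> f (x \<oplus>\<^bsub>M\<^esub> y) = f x \<oplus>\<^bsub>N\<^esub> f y"
    and "x \<in> carrier M \<Longrightarrow> f (c \<odot>\<^bsub>M\<^esub> x) = c \<odot>\<^bsub>N\<^esub> f x"
  using assms by (auto simp: linear_maps_def)

lemma linear_maps_group_hom:
  assumes "abelian_group M" "abelian_group N" "f \<in> linear_maps M N"
  shows "abelian_group_hom M N f"
  using assms
  by (intro abelian_group_homI)
     (auto simp: linear_maps_def group_hom_def group_hom_axioms_def hom_def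
       intro: abelian_group.a_group)

lemma linear_maps_zero:
  assumes "abelian_group M" "abelian_group N" "f \<in> linear_maps M N"
  shows "f \<zero>\<^bsub>M\<^esub> = \<zero>\<^bsub>N\<^esub>"
  using abelian_group_hom.hom_zero[OF linear_maps_group_hom[OF assms]] .

lemma linear_maps_minus:
  assumes "abelian_group M" "abelian_group N" "f \<in> linear_maps M N" "x \<in> carrier M" "y \<in> carrier M"
  shows "f (x \<ominus>\<^bsub>M\<^esub> y) = f x \<ominus>\<^bsub>N\<^esub> f y"
proof -
  interpret abelian_group_hom M N f by (rule linear_maps_group_hom[OF assms(1-3)])
  show ?thesis using assms(4,5) by (simp add: a_minus_def)
qed

context graded_vector_space
begin

lemma part_abelian_group: "abelian_group (part V k)"
  using part_module[of k] by (rule module.axioms(2))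

lemma part_zero: "\<zero>\<^bsub>part V k\<^esub> \<in> gcarrier V k"
  using part_abelian_group[of k] by (rule abelian_groupE(2))

lemma smult_closed: "v \<in> gcarrier V k \<Longrightarrow> c \<odot>\<^bsub>part V k\<^esub> v \<in> gcarrier V k"
  using module.smult_closed[OF part_module, of c] by (simp add: ring_of_type_algebra_def)

lemma smult_add_left: "v \<in> gcarrier V k \<Longrightarrow>
    (a + b) \<odot>\<^bsub>part V k\<^esub> v = a \<odot>\<^bsub>part V k\<^esub> v \<oplus>\<^bsub>part V k\<^esub> b \<odot>\<^bsub>part V k\<^esub> v"
  using module.smult_l_distr[OF part_module, of a b] by (simp add: ring_of_type_algebra_def)

lemma smult_add_right: "\<lbrakk>v \<in> gcarrier V k; w \<in> gcarrier V k\<rbrakk> \<Longrightarrow>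
    c \<odot>\<^bsub>part V k\<^esub> (v \<oplus>\<^bsub>part V k\<^esub> w) = c \<odot>\<^bsub>part V k\<^esub> v \<oplus>\<^bsub>part V k\<^esub> c \<odot>\<^bsub>part V k\<^esub> w"
  using module.smult_r_distr[OF part_module, of c] by (simp add: ring_of_type_algebra_def)

lemma smult_smult: "v \<in> gcarrier V k \<Longrightarrow>
    a \<odot>\<^bsub>part V k\<^esub> (b \<odot>\<^bsub>part V k\<^esub> v) = (a * b) \<odot>\<^bsub>part V k\<^esub> v"
  using module.smult_assoc1[OF part_module, of a b] by (simp add: ring_of_type_algebra_def)

lemma smult_1: "v \<in> gcarrier V k \<Longrightarrow> 1 \<odot>\<^bsub>part V k\<^esub> v = v"
  using module.smult_one[OF part_module] by (simp add: ring_of_type_algebra_def)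

lemma smult_zero: "c \<odot>\<^bsub>part V k\<^esub> \<zero>\<^bsub>part V k\<^esub> = \<zero>\<^bsub>part V k\<^esub>"
  using module.smult_r_null[OF part_module, of c] by (simp add: ring_of_type_algebra_def)

lemma add_closed: "\<lbrakk>v \<in> gcarrier V k; w \<in> gcarrier V k\<rbrakk> \<Longrightarrow> v \<oplus>\<^bsub>part V k\<^esub> w \<in> gcarrier V k"
  using part_abelian_group by (rule abelian_groupE(1))

lemma add_assoc: "\<lbrakk>u \<in> gcarrier V k; v \<in> gcarrier V k; w \<in> gcarrier V k\<rbrakk> \<Longrightarrow>
    (u \<oplus>\<^bsub>part V k\<^esub> v) \<oplus>\<^bsub>part V k\<^esub> w = u \<oplus>\<^bsub>part V k\<^esub> (v \<oplus>\<^bsub>part V k\<^esub> w)"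
  using part_abelian_group by (rule abelian_groupE(3))

lemma add_commute: "\<lbrakk>v \<in> gcarrier V k; w \<in> gcarrier V k\<rbrakk> \<Longrightarrow>
    v \<oplus>\<^bsub>part V k\<^esub> w = w \<oplus>\<^bsub>part V k\<^esub> v"
  using part_abelian_group by (rule abelian_groupE(4))

lemma add_zero_left: "v \<in> gcarrier V k \<Longrightarrow> \<zero>\<^bsub>part V k\<^esub> \<oplus>\<^bsub>part V k\<^esub> v = v"
  using part_abelian_group by (rule abelian_groupE(5))

lemma add_add_swap:
  "\<lbrakk>a \<in> gcarrier V k; b \<in> gcarrier V k; c \<in> gcarrier V k; d \<in> gcarrier V k\<rbrakk> \<Longrightarrow>
    (a \<oplus>\<^bsub>part V k\<^esub> b) \<oplus>\<^bsub>part V k\<^esub> (c \<oplus>\<^bsub>part V k\<^esub> d) =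
    (a \<oplus>\<^bsub>part V k\<^esub> c) \<oplus>\<^bsub>part V k\<^esub> (b \<oplus>\<^bsub>part V k\<^esub> d)"
  by (metis add_assoc add_closed add_commute)

lemma smult_minus_one: "v \<in> gcarrier V k \<Longrightarrow> (- 1) \<odot>\<^bsub>part V k\<^esub> v \<oplus>\<^bsub>part V k\<^esub> v = \<zero>\<^bsub>part V k\<^esub>"
proof -
  assume v: "v \<in> gcarrier V k"
  have "(- 1) \<odot>\<^bsub>part V k\<^esub> v \<oplus>\<^bsub>part V k\<^esub> v = (- 1 + 1) \<odot>\<^bsub>part V k\<^esub> v"
    by (simp only: smult_add_left[OF v] smult_1[OF v])
  also have "\<dots> = 0 \<odot>\<^bsub>part V k\<^esub> v" by simp
  also have "\<dots> = \<zero>\<^bsub>part V k\<^esub>"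
    using module.smult_l_null[OF part_module v] by (simp add: ring_of_type_algebra_def)
  finally show ?thesis .
qed

end


section \<open>Smooth bump functions on Euclidean space\<close>

text \<open>
  \<open>times_diff k f\<close> says that \<open>f\<close> is \<open>k\<close> times differentiable on the whole real line. Continuity of the
  \<open>k\<close>-th derivative is not part of it; it follows from \<open>times_diff (Suc k) f\<close>.
\<close>

fun times_diff :: "nat \<Rightarrow> (real \<Rightarrow> real) \<Rightarrow> bool"
  where
    "times_diff 0 f \<longleftrightarrow> True"
  | "times_diff (Suc k) f \<longleftrightarrow> (\<exists>f'. (\<forall>t. (f has_real_derivative f' t) (at t)) \<and> times_diff k f')"

lemma times_diff_SucI:
  "\<lbrakk>times_diff k f'; \<forall>t. (f has_real_derivative f' t) (at t)\<rbrakk> \<Longrightarrow> times_diff (Suc k) f"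
  by auto

lemma times_diff_SucD: "times_diff (Suc k) f \<Longrightarrow> times_diff k f"
proof (induction k arbitrary: f)
  case (Suc k)
  then show ?case by (metis times_diff.simps(2))
qed simp

lemma times_diff_const: "times_diff k (\<lambda>t. c)"
proof (induction k arbitrary: c)
  case (Suc k)
  have "\<forall>t. ((\<lambda>t. c) has_real_derivative 0) (at t)" by simp
  with Suc[of 0] show ?case by (rule times_diff_SucI)
qed simp

lemma times_diff_add: "times_diff k f \<Longrightarrow> times_diff k g \<Longrightarrow> times_diff k (\<lambda>t. f t + g t)"
proof (induction k arbitrary: f g)
  case (Suc k)
  obtain f' g' where d: "\<And>t. (f has_real_derivative f' t) (at t)" "times_diff k f'"
    "\<And>t. (g has_real_derivative g' t) (at t)" "times_diff k g'"
    using Suc.prems by auto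
  have "\<forall>t. ((\<lambda>t. f t + g t) has_real_derivative f' t + g' t) (at t)"
    using d by (auto intro!: derivative_eq_intros)
  with Suc.IH[OF d(2,4)] show ?case by (rule times_diff_SucI)
qed simp

lemma times_diff_mult: "times_diff k f \<Longrightarrow> times_diff k g \<Longrightarrow> times_diff k (\<lambda>t. f t * g t)"
proof (induction k arbitrary: f g)
  case (Suc k)
  obtain f' g' where d: "\<And>t. (f has_real_derivative f' t) (at t)" "times_diff k f'"
    "\<And>t. (g has_real_derivative g' t) (at t)" "times_diff k g'"
    using Suc.prems by auto
  have "times_diff k (\<lambda>t. f' t * g t + f t * g' t)"
    by (intro times_diff_add Suc.IH d times_diff_SucD[OF Suc.prems(1)] times_diff_SucD[OF Suc.prems(2)])
  moreover have "\<forall>t. ((\<lambda>t. f t * g t) has_real_derivative f' t * g t + f t * g' t) (at t)"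
    using d by (auto intro!: derivative_eq_intros)
  ultimately show ?case by (rule times_diff_SucI)
qed simp

lemma times_diff_inverse:
  "\<lbrakk>times_diff k f; \<And>t. f t \<noteq> 0\<rbrakk> \<Longrightarrow> times_diff k (\<lambda>t. inverse (f t))"
proof (induction k arbitrary: f)
  case (Suc k)
  obtain f' where d: "\<And>t. (f has_real_derivative f' t) (at t)" "times_diff k f'"
    using Suc.prems by auto
  have inv: "times_diff k (\<lambda>t. inverse (f t))"
    using Suc by (blast intro: times_diff_SucD)
  have "times_diff k (\<lambda>t. (- 1) * (inverse (f t) * (f' t * inverse (f t))))"
    by (intro times_diff_mult times_diff_const inv d)
  moreover have "\<forall>t. ((\<lambda>t. inverse (f t)) has_real_derivative
      (- 1) * (inverse (f t) * (f' t * inverse (f t)))) (at t)"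
    using DERIV_inverse'[OF d(1) Suc.prems(2)] by (auto simp: mult.assoc)
  ultimately show ?case by (rule times_diff_SucI)
qed simp

lemma times_diff_affine: "times_diff k f \<Longrightarrow> times_diff k (\<lambda>t. f (a * t + c))"
proof (induction k arbitrary: f)
  case (Suc k)
  obtain f' where d: "\<And>t. (f has_real_derivative f' t) (at t)" "times_diff k f'"
    using Suc.prems by auto
  have "times_diff k (\<lambda>t. f' (a * t + c) * a)"
    by (intro times_diff_mult times_diff_const Suc.IH d)
  moreover have "\<forall>t. ((\<lambda>t. f (a * t + c)) has_real_derivative f' (a * t + c) * a) (at t)"
    using d(1) by (auto intro!: derivative_eq_intros DERIV_chain2[of f])
  ultimately show ?case by (rule times_diff_SucI)
qed simp

text \<open>
  The functions \<open>t\<^sup>-\<^sup>n exp (- 1 / t)\<close> for \<open>t > 0\<close>, extended by zero. Their derivatives are combinations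
  of functions of the same family, also at the origin, so all of them are smooth.
\<close>

definition flat :: "nat \<Rightarrow> real \<Rightarrow> real"
  where "flat n t = (if t > 0 then inverse t ^ n * exp (- inverse t) else 0)"

lemma flat_tendsto_0: "(flat n \<longlongrightarrow> 0) (at 0)"
proof -
  have "((\<lambda>t. inverse t ^ n / exp (inverse t)) \<longlongrightarrow> 0) (at_right (0::real))"
    by (rule filterlim_compose[OF tendsto_power_div_exp_0 filterlim_inverse_at_top_right])
  then have "(flat n \<longlongrightarrow> 0) (at_right 0)"
    by (rule Lim_transform_eventually)
       (auto simp: flat_def eventually_at_filter exp_minus divide_inverse)
  moreover have "(flat n \<longlongrightarrow> 0) (at_left 0)"
    by (rule tendsto_eventually) (auto simp: flat_def eventually_at_filter)
  ultimately show ?thesis by (simp add: filterlim_split_at)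
qed

lemma DERIV_flat: "(flat n has_real_derivative flat (n + 2) t + (- real n) * flat (n + 1) t) (at t)"
proof -
  consider "t < 0" | "t = 0" | "t > 0" by linarith
  then show ?thesis
  proof cases
    case 1
    have "((\<lambda>t. 0) has_real_derivative 0) (at t)" by simp
    then have "(flat n has_real_derivative 0) (at t)"
      by (rule has_field_derivative_transform_within_open[where S = "{..<0}"])
         (use 1 in \<open>auto simp: flat_def\<close>)
    with 1 show ?thesis by (simp add: flat_def)
  next
    case 2
    have "((\<lambda>s. (flat n s - flat n 0) / (s - 0)) \<longlongrightarrow> 0) (at 0)"
      by (rule Lim_transform_eventually[OF flat_tendsto_0[of "Suc n"]])
         (auto simp: flat_def eventually_at_filter divide_inverse)
    with 2 show ?thesis by (simp add: has_field_derivative_iff flat_def)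
  next
    case 3
    have "((\<lambda>s. inverse s ^ n * exp (- inverse s)) has_real_derivative
        inverse t ^ (n + 2) * exp (- inverse t) - real n * (inverse t ^ (n + 1) * exp (- inverse t))) (at t)"
      using 3 by (cases n, auto intro!: derivative_eq_intros simp: algebra_simps power2_eq_square,
          metis One_nat_def power_eq_if)
    then have "(flat n has_real_derivative
        inverse t ^ (n + 2) * exp (- inverse t) - real n * (inverse t ^ (n + 1) * exp (- inverse t))) (at t)"
      by (rule has_field_derivative_transform_within_open[where S = "{0<..}"])
         (use 3 in \<open>auto simp: flat_def\<close>)
    with 3 show ?thesis by (simp add: flat_def)
  qed
qed

lemma times_diff_flat: "times_diff k (flat n)"
proof (induction k arbitrary: n)
  case (Suc k)
  have "times_diff k (\<lambda>t. flat (n + 2) t + (- real n) * flat (n + 1) t)"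
    by (intro times_diff_add times_diff_mult times_diff_const Suc)
  then show ?case by (rule times_diff_SucI) (use DERIV_flat in blast)
qed simp

lemma plateau_function:
  obtains \<beta> :: "real \<Rightarrow> real" where "\<And>k. times_diff k \<beta>"
    "\<And>t. \<bar>t\<bar> \<le> 1 \<Longrightarrow> \<beta> t = 1" "\<And>t. \<bar>t\<bar> \<ge> 2 \<Longrightarrow> \<beta> t = 0"
proof -
  have pos: "flat 0 t + flat 0 ((- 1) * t + 1) > 0" for t :: real
    by (cases "t > 0") (auto simp: flat_def add_pos_nonneg)
  \<comment> \<open>A smooth step from \<open>0\<close> on \<open>t \<le> 0\<close> to \<open>1\<close> on \<open>t \<ge> 1\<close>; the plateau is a rising times a falling step.\<close>
  define step where "step t = flat 0 t * inverse (flat 0 t + flat 0 ((- 1) * t + 1))" for t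
  have step: "times_diff k step" for k
    unfolding step_def using pos
    by (intro times_diff_mult times_diff_flat times_diff_inverse times_diff_add
        times_diff_affine) (metis less_irrefl)
  have step0: "step t = 0" if "t \<le> 0" for t using that by (simp add: step_def flat_def)
  have step1: "step t = 1" if "t \<ge> 1" for t using that by (simp add: step_def flat_def)
  show thesis
  proof
    show "times_diff k (\<lambda>t. step (1 * t + 2) * step ((- 1) * t + 2))" for k
      by (intro times_diff_mult times_diff_affine step)
    show "step (1 * t + 2) * step ((- 1) * t + 2) = 1" if "\<bar>t\<bar> \<le> 1" for t
      using that step1[of "1 * t + 2"] step1[of "(- 1) * t + 2"] by (simp add: abs_le_iff)
    show "step (1 * t + 2) * step ((- 1) * t + 2) = 0" if "\<bar>t\<bar> \<ge> 2" for t
      using that step0[of "1 * t + 2"] step0[of "(- 1) * t + 2"] by (auto simp: abs_if split: if_splits)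
  qed
qed

lemma continuous_map_Euclidean_coordinate:
  "continuous_map (subtopology (Euclidean_space m) U) euclideanreal (\<lambda>x. x i)"
  unfolding Euclidean_space_def
  by (intro continuous_map_from_subtopology continuous_map_product_projection) simp

text \<open>
  The \<open>i\<close>-th partial derivative of a product of functions of one coordinate each is again such a
  product, with the \<open>i\<close>-th factor replaced by its derivative. One more derivative than \<open>k\<close> is assumed
  so that the \<open>k\<close>-th derivatives are continuous.
\<close>

lemma C_diff_prod:
  "(\<And>i. i < m \<Longrightarrow> times_diff (Suc k) (g i)) \<Longrightarrow> C_diff m k U (\<lambda>x. \<Prod>i<m. g i (x i))"
proof (induction k arbitrary: g)
  case *: 0
  have "continuous_map euclideanreal euclideanreal (g i)" if "i < m" for i
    using *[OF that] by (auto intro: DERIV_continuous_on continuous_at_imp_continuous_on DERIV_isCont)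
  then show ?case
    by (auto intro!: continuous_map_prod
        continuous_map_compose[OF continuous_map_Euclidean_coordinate, unfolded o_def])
next
  case (Suc k)
  have cont: "continuous_map euclideanreal euclideanreal (g i)" if "i < m" for i
    using Suc.prems[OF that]
    by (auto intro: DERIV_continuous_on continuous_at_imp_continuous_on DERIV_isCont)
  have "\<exists>G. (\<forall>x\<in>U. ((\<lambda>t. \<Prod>j<m. g j ((x(i := t)) j)) has_real_derivative G x) (at (x i))) \<and> C_diff m k U G"
    if i: "i < m" for i
  proof -
    obtain g' where g': "\<And>t. (g i has_real_derivative g' t) (at t)" "times_diff (Suc k) g'"
      using Suc.prems[OF i] by (metis times_diff.simps(2))
    have split: "(\<Prod>j<m. f j) = f i * (\<Prod>j\<in>{..<m} - {i}. f j)" for f :: "nat \<Rightarrow> real"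
      using i by (simp add: prod.remove)
    have "C_diff m k U (\<lambda>x. \<Prod>j<m. (g(i := g')) j (x j))"
      using Suc.prems g'(2) by (intro Suc.IH) (auto intro: times_diff_SucD simp del: times_diff.simps)
    moreover have "((\<lambda>t. \<Prod>j<m. g j ((x(i := t)) j)) has_real_derivative
        (\<Prod>j<m. (g(i := g')) j (x j))) (at (x i))" for x
    proof -
      have 1: "(\<lambda>t. \<Prod>j<m. g j ((x(i := t)) j)) = (\<lambda>t. g i t * (\<Prod>j\<in>{..<m} - {i}. g j (x j)))"
        unfolding split by simp
      have 2: "(\<Prod>j<m. (g(i := g')) j (x j)) = g' (x i) * (\<Prod>j\<in>{..<m} - {i}. g j (x j))"
        unfolding split by simp
      show ?thesis unfolding 1 2 by (rule DERIV_cmult_right[OF g'(1)])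
    qed
    ultimately show ?thesis
      by (intro exI[of _ "\<lambda>x. \<Prod>j<m. (g(i := g')) j (x j)"]) simp
  qed
  with cont show ?case
    by (auto intro!: continuous_map_prod
        continuous_map_compose[OF continuous_map_Euclidean_coordinate, unfolded o_def])
qed

lemma C_diff_cong:
  assumes "C_diff m k U f" "U \<subseteq> topspace (Euclidean_space m)"
    and eq: "\<And>x. x \<in> topspace (Euclidean_space m) \<Longrightarrow> f x = g x"
  shows "C_diff m k U g"
proof -
  have cont: "continuous_map (subtopology (Euclidean_space m) U) euclideanreal g"
    if "continuous_map (subtopology (Euclidean_space m) U) euclideanreal f"
    using that by (rule continuous_map_eq) (auto intro: eq)
  show ?thesis
  proof (cases k)
    case 0
    with assms cont show ?thesis by simp
  next
    case (Suc j)
    have "f (x(i := t)) = g (x(i := t))" if "x \<in> U" "i < m" for x i t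
      using that assms(2) by (intro eq) (auto simp: topspace_Euclidean_space)
    with assms(1) cont show ?thesis unfolding Suc C_diff.simps by simp
  qed
qed

text \<open>
  The bump function is the product over the coordinates of rescaled plateau functions; its support
  lies in a cube around \<open>y\<close>. The function \<open>b\<close> is cut off outside \<open>B\<close> because the product ignores the
  coordinates from \<open>m\<close> on, so that it need not vanish at points outside \<open>\<real>\<^sup>m\<close>.
\<close>

lemma Euclidean_bump:
  assumes "openin (Euclidean_space m) U" "y \<in> U"
  obtains b :: "(nat \<Rightarrow> real) \<Rightarrow> real" and B N where
    "compactin (Euclidean_space m) B" "B \<subseteq> U" "openin (Euclidean_space m) N" "y \<in> N" "N \<subseteq> B"
    "\<And>x. x \<in> N \<Longrightarrow> b x = 1" "\<And>x. x \<notin> B \<Longrightarrow> b x = 0"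
    "\<And>S. S \<subseteq> topspace (Euclidean_space m) \<Longrightarrow> smooth_on m S b"
proof -
  have yE: "y \<in> topspace (Euclidean_space m)"
    using assms openin_subset by blast
  obtain T where T: "openin (powertop_real UNIV) T" "U = T \<inter> {x. \<forall>i\<ge>m. x i = 0}"
    using assms(1) unfolding Euclidean_space_def openin_subtopology by auto
  obtain Y where Y: "\<And>i. open (Y i)" "y \<in> Pi\<^sub>E UNIV Y" "Pi\<^sub>E UNIV Y \<subseteq> T"
  proof -
    have "y \<in> T" using T(2) assms(2) by simp
    then show ?thesis
      using T(1) that unfolding openin_product_topology_alt by simp meson
  qed
  have "\<forall>i. \<exists>e>0. \<forall>t. dist t (y i) < e \<longrightarrow> t \<in> Y i"
    using Y(1,2) by (auto simp: open_dist PiE_def Pi_def)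
  then obtain e where e: "\<And>i. e i > 0" "\<And>i t. dist t (y i) < e i \<Longrightarrow> t \<in> Y i"
    by metis
  \<comment> \<open>The cube \<open>B\<close> has radius \<open>2 * r\<close>, since the plateau function vanishes only from \<open>2\<close> on; the element
    \<open>1\<close> keeps the set nonempty when \<open>m = 0\<close>.\<close>
  define r where "r = Min (insert 1 (e ` {..<m})) / 3"
  have r: "r > 0" unfolding r_def using e(1) by (subst divide_pos_pos) auto
  have re: "2 * r < e i" if "i < m" for i
  proof -
    have "3 * r \<le> e i" unfolding r_def using that by simp
    with r show ?thesis by linarith
  qed
  define B where "B = {x. (\<forall>i<m. dist (y i) (x i) \<le> 2 * r) \<and> (\<forall>i\<ge>m. x i = 0)}"
  define N where "N = {x. (\<forall>i<m. dist (y i) (x i) < r) \<and> (\<forall>i\<ge>m. x i = 0)}"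
  obtain \<beta> :: "real \<Rightarrow> real" where \<beta>: "\<And>k. times_diff k \<beta>"
    "\<And>t. \<bar>t\<bar> \<le> 1 \<Longrightarrow> \<beta> t = 1" "\<And>t. \<bar>t\<bar> \<ge> 2 \<Longrightarrow> \<beta> t = 0"
    using plateau_function by blast
  define g where "g x = (\<Prod>i<m. \<beta> (inverse r * x i + (- y i / r)))" for x
  have g_eq: "g x = (\<Prod>i<m. \<beta> ((x i - y i) / r))" for x
    unfolding g_def by (simp add: divide_inverse algebra_simps)
  have g0: "g x = 0" if x: "x \<in> topspace (Euclidean_space m)" "x \<notin> B" for x
  proof -
    obtain i where i: "i < m" "\<not> dist (y i) (x i) \<le> 2 * r"
      using x by (auto simp: B_def topspace_Euclidean_space)
    then have "\<bar>(x i - y i) / r\<bar> \<ge> 2"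
      using r by (simp add: abs_divide le_divide_eq dist_real_def abs_minus_commute)
    then have "\<beta> ((x i - y i) / r) = 0" by (rule \<beta>(3))
    with i(1) show ?thesis unfolding g_eq by (intro prod_zero) auto
  qed
  define b where "b x = (if x \<in> B then g x else 0)" for x
  show thesis
  proof
    have "compactin (powertop_real UNIV) (Pi\<^sub>E UNIV (\<lambda>i. if i < m then cball (y i) (2 * r) else {0}))"
      unfolding compactin_PiE by (auto simp: compactin_euclidean_iff)
    moreover have "Pi\<^sub>E UNIV (\<lambda>i. if i < m then cball (y i) (2 * r) else {0}) = B"
      unfolding B_def PiE_UNIV_domain Pi_def by (simp add: set_eq_iff) (metis not_le)
    ultimately show "compactin (Euclidean_space m) B"
      unfolding Euclidean_space_def compactin_subtopology by (auto simp: B_def)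
    show "B \<subseteq> U"
    proof
      fix x assume x: "x \<in> B"
      have "x i \<in> Y i" for i
      proof (rule e(2))
        show "dist (x i) (y i) < e i"
        proof (cases "i < m")
          case True
          then have "dist (y i) (x i) \<le> 2 * r" using x by (simp add: B_def)
          with re[OF True] show ?thesis by (simp add: dist_commute)
        next
          case False
          with x yE e(1) show ?thesis by (simp add: B_def topspace_Euclidean_space)
        qed
      qed
      with Y(3) have "x \<in> T" by auto
      with x T(2) show "x \<in> U" by (auto simp: B_def)
    qed
    have "openin (powertop_real UNIV) (Pi\<^sub>E UNIV (\<lambda>i. if i < m then ball (y i) r else UNIV))"
      by (rule product_topology_basis) (auto intro: finite_subset[of _ "{..<m}"])
    from openin_subtopology_Int[OF this, of "{x. \<forall>i\<ge>m. x i = 0}"]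
    have "openin (Euclidean_space m)
        (Pi\<^sub>E UNIV (\<lambda>i. if i < m then ball (y i) r else UNIV) \<inter> {x. \<forall>i\<ge>m. x i = 0})"
      unfolding Euclidean_space_def .
    moreover have "Pi\<^sub>E UNIV (\<lambda>i. if i < m then ball (y i) r else UNIV) \<inter> {x. \<forall>i\<ge>m. x i = 0} = N"
      unfolding N_def PiE_UNIV_domain Pi_def by (simp add: set_eq_iff)
    ultimately show "openin (Euclidean_space m) N" by simp
    show "y \<in> N" using yE r by (simp add: N_def topspace_Euclidean_space)
    show NB: "N \<subseteq> B"
    proof
      fix x assume x: "x \<in> N"
      have "dist (y i) (x i) \<le> 2 * r" if "i < m" for i
      proof -
        have "dist (y i) (x i) < r" using x that by (simp add: N_def)
        with r show ?thesis by linarith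
      qed
      with x show "x \<in> B" by (simp add: N_def B_def)
    qed
    show "b x = 1" if "x \<in> N" for x
    proof -
      have "\<bar>(x i - y i) / r\<bar> \<le> 1" if "i < m" for i
        using \<open>x \<in> N\<close> that r by (auto simp: N_def abs_divide dist_real_def abs_minus_commute less_imp_le)
      then have "g x = 1" unfolding g_eq using \<beta>(2) by simp
      with that NB show ?thesis by (auto simp: b_def)
    qed
    show "b x = 0" if "x \<notin> B" for x using that by (simp add: b_def)
    show "smooth_on m S b" if "S \<subseteq> topspace (Euclidean_space m)" for S
      unfolding smooth_on_def
    proof
      fix k
      have "C_diff m k S g"
        unfolding g_def by (intro C_diff_prod times_diff_affine \<beta>(1))
      then show "C_diff m k S b"
        by (rule C_diff_cong[OF _ that]) (use g0 in \<open>auto simp: b_def\<close>)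
    qed
  qed
qed


section \<open>Sections of sheaves of graded spaces\<close>

context graded_sheaf
begin

lemma sections_abelian_group: "openin M U \<Longrightarrow> abelian_group (part (G U) k)"
  using graded_vector_space.part_abelian_group[OF sections] .

lemma zero_section: "openin M U \<Longrightarrow> \<zero>\<^bsub>part (G U) k\<^esub> \<in> gcarrier (G U) k"
  using graded_vector_space.part_zero[OF sections] .

lemma res_linear_maps:
  "\<lbrakk>openin M U; openin M V; V \<subseteq> U\<rbrakk> \<Longrightarrow> \<rho> U V k \<in> linear_maps (part (G U) k) (part (G V) k)"
  using res_linear[of U V] by (simp add: graded_linear_def)

lemmas res_closed = linear_mapsD(1)[OF res_linear_maps]
  and res_add = linear_mapsD(2)[OF res_linear_maps]
  and res_smult = linear_mapsD(3)[OF res_linear_maps]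

lemma res_zero:
  "\<lbrakk>openin M U; openin M V; V \<subseteq> U\<rbrakk> \<Longrightarrow> \<rho> U V k \<zero>\<^bsub>part (G U) k\<^esub> = \<zero>\<^bsub>part (G V) k\<^esub>"
  by (rule linear_maps_zero[OF sections_abelian_group sections_abelian_group res_linear_maps])

lemma res_minus:
  "\<lbrakk>openin M U; openin M V; V \<subseteq> U; s \<in> gcarrier (G U) k; t \<in> gcarrier (G U) k\<rbrakk> \<Longrightarrow>
    \<rho> U V k (s \<ominus>\<^bsub>part (G U) k\<^esub> t) = \<rho> U V k s \<ominus>\<^bsub>part (G V) k\<^esub> \<rho> U V k t"
  by (rule linear_maps_minus[OF sections_abelian_group sections_abelian_group res_linear_maps])

lemma res_agree_mono:
  assumes "openin M U" "openin M V" "openin M N" "openin M N'" "N \<subseteq> U" "N \<subseteq> V" "N' \<subseteq> N"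
    and "s \<in> gcarrier (G U) k" "t \<in> gcarrier (G V) k" "\<rho> U N k s = \<rho> V N k t"
  shows "\<rho> U N' k s = \<rho> V N' k t"
  using res_comp[of U N N' s k] res_comp[of V N N' t k] assms by simp

text \<open>Separation is contained in the uniqueness part of the gluing axiom.\<close>

lemma sections_eqI:
  assumes "openin M U" "s \<in> gcarrier (G U) k" "t \<in> gcarrier (G U) k"
    and loc: "\<And>x. x \<in> U \<Longrightarrow> \<exists>N. openin M N \<and> x \<in> N \<and> N \<subseteq> U \<and> \<rho> U N k s = \<rho> U N k t"
  shows "s = t"
proof -
  define \<U> where "\<U> = {N. openin M N \<and> N \<subseteq> U \<and> \<rho> U N k s = \<rho> U N k t}"
  have U: "\<Union>\<U> = U" using loc by (fastforce simp: \<U>_def)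
  have "\<exists>!r. r \<in> gcarrier (G (\<Union>\<U>)) k \<and> (\<forall>V \<in> \<U>. \<rho> (\<Union>\<U>) V k r = \<rho> U V k s)"
  proof (rule gluing)
    fix V W assume VW: "V \<in> \<U>" "W \<in> \<U>"
    then have op: "openin M V" "V \<subseteq> U" "openin M W" "W \<subseteq> U" by (simp_all add: \<U>_def)
    show "openin M V" by fact
    show "\<rho> U V k s \<in> gcarrier (G V) k" by (rule res_closed) (fact assms op)+
    have "openin M (V \<inter> W)" using op by blast
    then show "\<rho> V (V \<inter> W) k (\<rho> U V k s) = \<rho> W (V \<inter> W) k (\<rho> U W k s)"
      using op assms(1,2) by (simp add: res_comp)
  qed
  moreover have "\<forall>V\<in>\<U>. \<rho> U V k t = \<rho> U V k s" by (simp add: \<U>_def)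
  ultimately show ?thesis
    using assms(2,3) unfolding U by blast
qed

text \<open>
  A section over \<open>V\<close> that vanishes off a set \<open>A \<subseteq> V\<close>, closed in \<open>M\<close>, is glued with the zero section over
  \<open>U - A\<close>.
\<close>

lemma extend_by_zero:
  assumes "openin M U" "openin M V" "V \<subseteq> U" "closedin M A" "A \<subseteq> V"
    and s: "s \<in> gcarrier (G V) k" "\<rho> V (V - A) k s = \<zero>\<^bsub>part (G (V - A)) k\<^esub>"
  obtains r where "r \<in> gcarrier (G U) k" "\<rho> U V k r = s" "\<rho> U (U - A) k r = \<zero>\<^bsub>part (G (U - A)) k\<^esub>"
proof -
  have op: "openin M (U - A)" "openin M (V - A)"
    using assms by auto
  \<comment> \<open>If the two members \<open>V\<close> and \<open>U - A\<close> of the cover coincide, then \<open>A\<close> is empty and \<open>s\<close> is itself zero.\<close>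
  define t where "t W = (if W = V then s else \<zero>\<^bsub>part (G W) k\<^esub>)" for W
  have Un: "\<Union>{V, U - A} = U" using assms by auto
  have Int: "V \<inter> (U - A) = V - A" "(U - A) \<inter> V = V - A" using assms by auto
  have "\<exists>!r. r \<in> gcarrier (G (\<Union>{V, U - A})) k \<and> (\<forall>W \<in> {V, U - A}. \<rho> (\<Union>{V, U - A}) W k r = t W)"
  proof (rule gluing)
    have sym: "\<rho> V (V - A) k (t V) = \<rho> (U - A) (V - A) k (t (U - A))"
    proof (cases "U - A = V")
      case False
      have "V - A \<subseteq> U - A" using assms(3) by blast
      with False op s(2) show ?thesis by (simp add: t_def res_zero)
    qed simp
    fix W W' assume WW': "W \<in> {V, U - A}" "W' \<in> {V, U - A}"
    show "openin M W" using WW'(1) assms(2) op by blast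
    then show "t W \<in> gcarrier (G W) k" using s(1) by (simp add: t_def zero_section)
    consider "W = W'" | "W = V" "W' = U - A" | "W = U - A" "W' = V" using WW' by blast
    then show "\<rho> W (W \<inter> W') k (t W) = \<rho> W' (W \<inter> W') k (t W')"
      by cases (simp_all only: Int sym)
  qed
  then obtain r where r: "r \<in> gcarrier (G U) k" "\<rho> U V k r = t V" "\<rho> U (U - A) k r = t (U - A)"
    unfolding Un by blast
  have "t (U - A) = \<zero>\<^bsub>part (G (U - A)) k\<^esub>"
  proof (cases "U - A = V")
    case True
    then have "V - A = V" by auto
    with s True assms(2) show ?thesis by (simp add: t_def res_id)
  qed (simp add: t_def)
  with r that show ?thesis by (simp add: t_def)
qed

end


section \<open>Bump functions on a graded manifold\<close>

text \<open>
  A bump function is given together with a closed set \<open>A\<close> outside of which it vanishes, as a section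
  over the complement of \<open>A\<close>, and a neighbourhood \<open>N\<close> of the point over which it is the unit.
  In a chart it is the series whose only nonzero coefficient is the constant one, which is a smooth
  bump function of compact support; the preimage of that support is compact, hence closed in the
  Hausdorff space \<open>M\<close>, which is what the extension by zero requires.
\<close>

lemma (in graded_manifold) bump_function:
  assumes "openin M V" "x \<in> V"
  obtains f A N where "f \<in> gcarrier (C (topspace M)) 0"
    "closedin M A" "A \<subseteq> V" "openin M N" "x \<in> N" "N \<subseteq> A"
    "\<rho> (topspace M) N 0 f = gone (C N)"
    "\<rho> (topspace M) (topspace M - A) 0 f = \<zero>\<^bsub>part (C (topspace M - A)) 0\<^esub>"
proof -
  let ?m = "n 0" and ?E = "Euclidean_space (n 0)"
  have "x \<in> topspace M" using assms openin_subset by blast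
  then obtain W \<phi> h where "x \<in> W" and chart: "graded_chart n M C \<rho> W \<phi> h"
    using charts by blast
  have W: "openin M W" "openin ?E (\<phi> ` W)"
    and hom: "homeomorphic_map (subtopology M W) (subtopology ?E (\<phi> ` W)) \<phi>"
    using chart by (simp_all add: graded_chart_def)
  have WM: "W \<subseteq> topspace M" using W(1) by (rule openin_subset)
  have iso: "graded_algebra_iso (C U) (model_algebra n (\<phi> ` U)) (h U)" if "openin M U" "U \<subseteq> W" for U
    using chart that by (simp add: graded_chart_def)
  have h_res: "h V k (\<rho> U V k f) = model_res (\<phi> ` V) (h U k f)"
    if "f \<in> gcarrier (C U) k" "openin M U" "openin M V" "V \<subseteq> U" "U \<subseteq> W" for U V k f
    using chart that by (simp add: graded_chart_def)
  have inj: "inj_on (h U k) (gcarrier (C U) k)" if "openin M U" "U \<subseteq> W" for U k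
    using iso[OF that] by (auto simp: graded_algebra_iso_def bij_betw_def)
  obtain g where g: "homeomorphic_maps (subtopology M W) (subtopology ?E (\<phi> ` W)) \<phi> g"
    using hom homeomorphic_map_maps by blast
  have g\<phi>: "g (\<phi> w) = w" if "w \<in> W" for w
    using g that WM by (auto simp: homeomorphic_maps_def)
  have V': "openin M (V \<inter> W)" using assms W by blast
  have "openin (subtopology ?E (\<phi> ` W)) (\<phi> ` (V \<inter> W))"
    using homeomorphic_imp_open_map[OF hom] V' W(1)
    by (auto simp: open_map_def openin_open_subtopology)
  then have op: "openin ?E (\<phi> ` (V \<inter> W))"
    using W(2) by (rule openin_trans_full)
  have y: "\<phi> x \<in> \<phi> ` (V \<inter> W)" using assms(2) \<open>x \<in> W\<close> by blast
  obtain b B N' where b: "compactin ?E B" "B \<subseteq> \<phi> ` (V \<inter> W)"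
      "openin ?E N'" "\<phi> x \<in> N'" "N' \<subseteq> B"
      "\<And>z. z \<in> N' \<Longrightarrow> b z = 1" "\<And>z. z \<notin> B \<Longrightarrow> b z = 0"
      "\<And>S. S \<subseteq> topspace ?E \<Longrightarrow> smooth_on ?m S b"
    by (rule Euclidean_bump[OF op y]) (rule that)
  define A where "A = {w \<in> W. \<phi> w \<in> B}"
  define N where "N = {w \<in> W. \<phi> w \<in> N'}"
  have "A = g ` B"
  proof (intro equalityI subsetI)
    fix w assume "w \<in> A"
    then show "w \<in> g ` B" using g\<phi>[of w] by (intro image_eqI[of _ _ "\<phi> w"]) (simp_all add: A_def)
  next
    fix w assume "w \<in> g ` B"
    then obtain v where "v \<in> V \<inter> W" "\<phi> v \<in> B" "w = g (\<phi> v)" using b(2) by blast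
    then show "w \<in> A" by (simp add: A_def g\<phi>)
  qed
  moreover have "compactin (subtopology M W) (g ` B)"
    using g b(1,2) unfolding homeomorphic_maps_def
    by (intro image_compactin[where X = "subtopology ?E (\<phi> ` W)"]) (auto simp: compactin_subtopology)
  ultimately have "compactin M A" by (simp add: compactin_subtopology)
  then have A: "closedin M A"
    using hausdorff compactin_imp_closedin by blast
  have AV: "A \<subseteq> V"
  proof
    fix w assume w: "w \<in> A"
    then obtain v where "v \<in> V \<inter> W" "\<phi> w = \<phi> v" using b(2) unfolding A_def by blast
    moreover have "w \<in> W" using w by (simp add: A_def)
    ultimately have "w = v" using g\<phi>[of w] g\<phi>[of v] by (metis IntD2)
    with \<open>v \<in> V \<inter> W\<close> show "w \<in> V" by blast
  qed
  have "openin (subtopology M W) {w \<in> topspace (subtopology M W). \<phi> w \<in> N' \<inter> \<phi> ` W}"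
    using hom b(3) W(2)
    by (intro openin_continuous_map_preimage[OF homeomorphic_imp_continuous_map]) (auto simp: openin_open_subtopology)
  moreover have "{w \<in> topspace (subtopology M W). \<phi> w \<in> N' \<inter> \<phi> ` W} = N"
    using WM by (auto simp: N_def)
  ultimately have N: "openin M N" using W(1) by (simp add: openin_open_subtopology)
  have WA: "openin M (W - A)" using W(1) A by blast
  have NA: "N \<subseteq> A" "A \<subseteq> W" "N \<subseteq> W" using b(5) by (auto simp: N_def A_def)
  define f0 :: "(int \<times> nat \<Rightarrow> nat) \<Rightarrow> (nat \<Rightarrow> real) \<Rightarrow> real"
    where "f0 = (\<lambda>p z. if p = (\<lambda>_. 0) then b z else 0)"
  have "f0 \<in> gcarrier (model_algebra n (\<phi> ` W)) 0"
  proof -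
    have "smooth_on ?m (\<phi> ` W) (\<lambda>z. 0)"
    proof -
      have "C_diff ?m k (\<phi> ` W) (\<lambda>z. 0)" for k
        by (induction k) (auto intro!: exI[of _ "\<lambda>z. 0"])
      then show ?thesis by (simp add: smooth_on_def)
    qed
    moreover have "smooth_on ?m (\<phi> ` W) b"
      using b(8) W(2) openin_subset by blast
    ultimately have "smooth_on ?m (\<phi> ` W) (f0 p)" for p
      by (cases "p = (\<lambda>_. 0)") (simp_all add: f0_def)
    moreover have "(\<lambda>_. 0) \<in> multi_indices n 0" by (simp add: multi_indices_def)
    moreover have "b z = 0" if "z \<notin> \<phi> ` W" for z using b(2,7) that by blast
    ultimately show ?thesis by (auto simp: f0_def model_algebra_def)
  qed
  moreover have surj: "h W 0 ` gcarrier (C W) 0 = gcarrier (model_algebra n (\<phi> ` W)) 0"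
    using iso[OF W(1) subset_refl] by (simp add: graded_algebra_iso_def bij_betw_def)
  ultimately obtain f1 where f1: "f1 \<in> gcarrier (C W) 0" "h W 0 f1 = f0"
    using surj by (metis imageE)
  have one: "\<rho> W N 0 f1 = gone (C N)"
  proof (rule inj_onD[OF inj[OF N NA(3)]])
    have "h N 0 (\<rho> W N 0 f1) = model_res (\<phi> ` N) f0"
      using h_res[OF f1(1) W(1) N NA(3)] f1(2) by simp
    also have "\<dots> = gone (model_algebra n (\<phi> ` N))"
      using b(6) by (auto simp: model_res_def f0_def model_algebra_def N_def fun_eq_iff)
    also have "\<dots> = h N 0 (gone (C N))"
      using iso[OF N NA(3)] by (simp add: graded_algebra_iso_def)
    finally show "h N 0 (\<rho> W N 0 f1) = h N 0 (gone (C N))" .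
  qed (intro res_closed graded_comm_algebra.gone_closed algebras W(1) N NA(3) f1(1))+
  have zero: "\<rho> W (W - A) 0 f1 = \<zero>\<^bsub>part (C (W - A)) 0\<^esub>"
  proof (rule inj_onD[OF inj[OF WA]])
    let ?P = "model_algebra n (\<phi> ` (W - A))"
    have "h (W - A) 0 (\<rho> W (W - A) 0 f1) = model_res (\<phi> ` (W - A)) f0"
      using h_res[OF f1(1) W(1) WA] f1(2) by simp
    also have "\<dots> = \<zero>\<^bsub>part ?P 0\<^esub>"
      using b(7) by (auto simp: model_res_def f0_def model_algebra_def A_def fun_eq_iff)
    also have "\<dots> = h (W - A) 0 \<zero>\<^bsub>part (C (W - A)) 0\<^esub>"
    proof -
      have lin: "h (W - A) 0 \<in> linear_maps (part (C (W - A)) 0) (part ?P 0)"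
        using iso[OF WA] by (simp add: graded_algebra_iso_def graded_linear_def)
      \<comment> \<open>Zero is written as a multiple by the scalar \<open>0\<close>, which avoids showing that the model is a module.\<close>
      let ?z = "\<zero>\<^bsub>part (C (W - A)) 0\<^esub>"
      have "?z = 0 \<odot>\<^bsub>part (C (W - A)) 0\<^esub> ?z"
        using module.smult_r_null[OF graded_vector_space.part_module[OF sections[OF WA]], of 0 0]
        by (simp add: ring_of_type_algebra_def)
      then have "h (W - A) 0 ?z = 0 \<odot>\<^bsub>part ?P 0\<^esub> h (W - A) 0 ?z"
        using linear_mapsD(3)[OF lin zero_section[OF WA], of 0] by simp
      then show ?thesis by (simp add: model_algebra_def)
    qed
    finally show "h (W - A) 0 (\<rho> W (W - A) 0 f1) = h (W - A) 0 \<zero>\<^bsub>part (C (W - A)) 0\<^esub>" .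
  qed (intro res_closed zero_section W(1) WA Diff_subset f1(1))+
  obtain f where f: "f \<in> gcarrier (C (topspace M)) 0" "\<rho> (topspace M) W 0 f = f1"
      "\<rho> (topspace M) (topspace M - A) 0 f = \<zero>\<^bsub>part (C (topspace M - A)) 0\<^esub>"
    using extend_by_zero[OF openin_topspace W(1) WM A NA(2) f1(1) zero] .
  have "\<rho> (topspace M) N 0 f = gone (C N)"
    using res_comp[OF openin_topspace W(1) N NA(3) WM f(1)] one f(2) by simp
  moreover have "x \<in> N" using \<open>x \<in> W\<close> b(4) by (simp add: N_def)
  ultimately show thesis using that[OF f(1) A AV N _ NA(1) _ f(3)] by blast
qed


section \<open>The graded module of local operators\<close>

context sheaf_of_graded_modules
begin

abbreviation "L \<equiv> Loc M E \<sigma>"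

lemma LocD:
  assumes "F \<in> gcarrier (L U) d"
  shows "F k \<in> linear_maps (part (E U) k) (part (E U) (k + d))"
    and "F k \<in> extensional (gcarrier (E U) k)"
    and "\<lbrakk>\<psi> \<in> gcarrier (E U) k; openin M V; V \<subseteq> U; \<sigma> U V k \<psi> = \<zero>\<^bsub>part (E V) k\<^esub>\<rbrakk> \<Longrightarrow>
      \<sigma> U V (k + d) (F k \<psi>) = \<zero>\<^bsub>part (E V) (k + d)\<^esub>"
  using assms by (simp_all add: Loc_def local_operators_def graded_linear_def)

lemmas Loc_closed = linear_mapsD(1)[OF LocD(1)]
  and Loc_add = linear_mapsD(2)[OF LocD(1)]
  and Loc_smult = linear_mapsD(3)[OF LocD(1)]

lemma LocI:
  assumes "\<And>k \<psi>. \<psi> \<in> gcarrier (E U) k \<Longrightarrow> F k \<psi> \<in> gcarrier (E U) (k + d)"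
    and "\<And>k \<psi> \<phi>. \<lbrakk>\<psi> \<in> gcarrier (E U) k; \<phi> \<in> gcarrier (E U) k\<rbrakk> \<Longrightarrow>
      F k (\<psi> \<oplus>\<^bsub>part (E U) k\<^esub> \<phi>) = F k \<psi> \<oplus>\<^bsub>part (E U) (k + d)\<^esub> F k \<phi>"
    and "\<And>k c \<psi>. \<psi> \<in> gcarrier (E U) k \<Longrightarrow>
      F k (c \<odot>\<^bsub>part (E U) k\<^esub> \<psi>) = c \<odot>\<^bsub>part (E U) (k + d)\<^esub> F k \<psi>"
    and "\<And>k V \<psi>. \<lbrakk>\<psi> \<in> gcarrier (E U) k; openin M V; V \<subseteq> U; \<sigma> U V k \<psi> = \<zero>\<^bsub>part (E V) k\<^esub>\<rbrakk> \<Longrightarrow>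
      \<sigma> U V (k + d) (F k \<psi>) = \<zero>\<^bsub>part (E V) (k + d)\<^esub>"
    and "\<And>k. F k \<in> extensional (gcarrier (E U) k)"
  shows "F \<in> gcarrier (L U) d"
  using assms by (simp add: Loc_def local_operators_def graded_linear_def linear_maps_def)

lemma Loc_eqI:
  assumes "F \<in> gcarrier (L U) d" "G \<in> gcarrier (L U) d"
    and "\<And>k \<psi>. \<psi> \<in> gcarrier (E U) k \<Longrightarrow> F k \<psi> = G k \<psi>"
  shows "F = G"
  using assms(3) LocD(2)[OF assms(1)] LocD(2)[OF assms(2)] by (intro ext) (metis extensionalityI)

text \<open>Locality in the form in which it is used: agreeing sections have agreeing images.\<close>

lemma Loc_res_cong:
  assumes F: "F \<in> gcarrier (L U) d" and op: "openin M U" "openin M V" "V \<subseteq> U"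
    and \<psi>: "\<psi> \<in> gcarrier (E U) k" "\<phi> \<in> gcarrier (E U) k" "\<sigma> U V k \<psi> = \<sigma> U V k \<phi>"
  shows "\<sigma> U V (k + d) (F k \<psi>) = \<sigma> U V (k + d) (F k \<phi>)"
proof -
  let ?P = "part (E U) k" and ?Q = "part (E V) k" and ?R = "part (E V) (k + d)"
  note ab = sections_abelian_group
  interpret P: abelian_group ?P by (rule ab[OF op(1)])
  interpret Q: abelian_group ?Q by (rule ab[OF op(2)])
  interpret R: abelian_group ?R by (rule ab[OF op(2)])
  have cl: "\<sigma> U V k \<phi> \<in> carrier ?Q" "\<sigma> U V (k + d) (F k \<psi>) \<in> carrier ?R"
      "\<sigma> U V (k + d) (F k \<phi>) \<in> carrier ?R"
    using res_closed[OF op] Loc_closed[OF F] \<psi> by blast+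
  have "\<sigma> U V k (\<psi> \<ominus>\<^bsub>?P\<^esub> \<phi>) = \<zero>\<^bsub>?Q\<^esub>"
    unfolding res_minus[OF op \<psi>(1,2)] \<psi>(3) using cl(1) by (simp add: a_minus_def Q.r_neg)
  then have "\<sigma> U V (k + d) (F k (\<psi> \<ominus>\<^bsub>?P\<^esub> \<phi>)) = \<zero>\<^bsub>?R\<^esub>"
    using LocD(3)[OF F _ op(2,3)] \<psi> P.minus_closed by blast
  then have "\<sigma> U V (k + d) (F k \<psi>) \<ominus>\<^bsub>?R\<^esub> \<sigma> U V (k + d) (F k \<phi>) = \<zero>\<^bsub>?R\<^esub>"
    using linear_maps_minus[OF ab[OF op(1)] ab[OF op(1)] LocD(1)[OF F] \<psi>(1,2)]
      res_minus[OF op Loc_closed[OF F \<psi>(1)] Loc_closed[OF F \<psi>(2)]] by simp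
  then show ?thesis
    using cl(2,3) by (metis R.a_inv_closed R.minus_eq R.minus_equality R.minus_minus R.add.m_comm)
qed

text \<open>The operations of \<^const>\<open>Loc\<close> are used through their values on sections.\<close>

lemma Loc_zero_apply: "\<psi> \<in> gcarrier (E U) k \<Longrightarrow> \<zero>\<^bsub>part (L U) d\<^esub> k \<psi> = \<zero>\<^bsub>part (E U) (k + d)\<^esub>"
  and Loc_add_apply: "\<psi> \<in> gcarrier (E U) k \<Longrightarrow>
    (F \<oplus>\<^bsub>part (L U) d\<^esub> G) k \<psi> = F k \<psi> \<oplus>\<^bsub>part (E U) (k + d)\<^esub> G k \<psi>"
  and Loc_smult_apply: "\<psi> \<in> gcarrier (E U) k \<Longrightarrow>
    (c \<odot>\<^bsub>part (L U) d\<^esub> F) k \<psi> = c \<odot>\<^bsub>part (E U) (k + d)\<^esub> F k \<psi>"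
  and Loc_gact_apply: "\<psi> \<in> gcarrier (E U) k \<Longrightarrow>
    gact (L U) i d f F k \<psi> = gact (E U) i (k + d) f (F k \<psi>)"
  by (simp_all add: Loc_def)

lemma Loc_extensional:
  "\<zero>\<^bsub>part (L U) d\<^esub> k \<in> extensional (gcarrier (E U) k)"
  "(F \<oplus>\<^bsub>part (L U) d\<^esub> G) k \<in> extensional (gcarrier (E U) k)"
  "(c \<odot>\<^bsub>part (L U) d\<^esub> F) k \<in> extensional (gcarrier (E U) k)"
  "gact (L U) i d f F k \<in> extensional (gcarrier (E U) k)"
  by (simp_all add: Loc_def)

context
  fixes U assumes U: "openin M U"
begin

interpretation EU: graded_vector_space "E U" by (rule sections[OF U])

interpretation EU: graded_module "C U" "E U" by (rule modules[OF U])

lemma Loc_zero_closed: "\<zero>\<^bsub>part (L U) d\<^esub> \<in> gcarrier (L U) d"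
  by (rule LocI)
     (simp_all add: Loc_zero_apply Loc_extensional EU.add_closed EU.smult_closed EU.part_zero
       EU.add_zero_left EU.smult_zero res_zero U)

lemma Loc_add_closed:
  assumes F: "F \<in> gcarrier (L U) d" and G: "G \<in> gcarrier (L U) d"
  shows "F \<oplus>\<^bsub>part (L U) d\<^esub> G \<in> gcarrier (L U) d"
proof (rule LocI)
  note cl = Loc_closed[OF F] Loc_closed[OF G]
  fix k \<psi> assume \<psi>: "\<psi> \<in> gcarrier (E U) k"
  show "(F \<oplus>\<^bsub>part (L U) d\<^esub> G) k \<psi> \<in> gcarrier (E U) (k + d)"
    using \<psi> cl by (simp add: Loc_add_apply EU.add_closed)
  show "(F \<oplus>\<^bsub>part (L U) d\<^esub> G) k (c \<odot>\<^bsub>part (E U) k\<^esub> \<psi>) =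
      c \<odot>\<^bsub>part (E U) (k + d)\<^esub> (F \<oplus>\<^bsub>part (L U) d\<^esub> G) k \<psi>" for c
    using \<psi> cl
    by (simp add: Loc_add_apply EU.smult_closed Loc_smult[OF F] Loc_smult[OF G] EU.smult_add_right)
  show "(F \<oplus>\<^bsub>part (L U) d\<^esub> G) k (\<psi> \<oplus>\<^bsub>part (E U) k\<^esub> \<phi>) =
      (F \<oplus>\<^bsub>part (L U) d\<^esub> G) k \<psi> \<oplus>\<^bsub>part (E U) (k + d)\<^esub> (F \<oplus>\<^bsub>part (L U) d\<^esub> G) k \<phi>"
    if "\<phi> \<in> gcarrier (E U) k" for \<phi>
    using \<psi> that cl
    by (simp add: Loc_add_apply EU.add_closed Loc_add[OF F] Loc_add[OF G] EU.add_add_swap)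
  show "\<sigma> U V (k + d) ((F \<oplus>\<^bsub>part (L U) d\<^esub> G) k \<psi>) = \<zero>\<^bsub>part (E V) (k + d)\<^esub>"
    if V: "openin M V" "V \<subseteq> U" "\<sigma> U V k \<psi> = \<zero>\<^bsub>part (E V) k\<^esub>" for V
    using \<psi> V cl LocD(3)[OF F \<psi> V] LocD(3)[OF G \<psi> V]
      graded_vector_space.add_zero_left[OF sections[OF V(1)] zero_section[OF V(1)]]
    by (simp add: Loc_add_apply res_add[OF U])
qed (rule Loc_extensional)

lemma Loc_smult_closed:
  assumes F: "F \<in> gcarrier (L U) d"
  shows "c \<odot>\<^bsub>part (L U) d\<^esub> F \<in> gcarrier (L U) d"
proof (rule LocI)
  note cl = Loc_closed[OF F]
  fix k \<psi> assume \<psi>: "\<psi> \<in> gcarrier (E U) k"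
  show "(c \<odot>\<^bsub>part (L U) d\<^esub> F) k \<psi> \<in> gcarrier (E U) (k + d)"
    using \<psi> cl by (simp add: Loc_smult_apply EU.smult_closed)
  show "(c \<odot>\<^bsub>part (L U) d\<^esub> F) k (a \<odot>\<^bsub>part (E U) k\<^esub> \<psi>) =
      a \<odot>\<^bsub>part (E U) (k + d)\<^esub> (c \<odot>\<^bsub>part (L U) d\<^esub> F) k \<psi>" for a
    using \<psi> cl
    by (simp add: Loc_smult_apply EU.smult_closed Loc_smult[OF F] EU.smult_smult mult.commute)
  show "(c \<odot>\<^bsub>part (L U) d\<^esub> F) k (\<psi> \<oplus>\<^bsub>part (E U) k\<^esub> \<phi>) =
      (c \<odot>\<^bsub>part (L U) d\<^esub> F) k \<psi> \<oplus>\<^bsub>part (E U) (k + d)\<^esub> (c \<odot>\<^bsub>part (L U) d\<^esub> F) k \<phi>"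
    if "\<phi> \<in> gcarrier (E U) k" for \<phi>
    using \<psi> that cl
    by (simp add: Loc_smult_apply EU.add_closed Loc_add[OF F] EU.smult_add_right)
  show "\<sigma> U V (k + d) ((c \<odot>\<^bsub>part (L U) d\<^esub> F) k \<psi>) = \<zero>\<^bsub>part (E V) (k + d)\<^esub>"
    if V: "openin M V" "V \<subseteq> U" "\<sigma> U V k \<psi> = \<zero>\<^bsub>part (E V) k\<^esub>" for V
    using \<psi> V cl LocD(3)[OF F \<psi> V] graded_vector_space.smult_zero[OF sections[OF V(1)]]
    by (simp add: Loc_smult_apply res_smult[OF U])
qed (rule Loc_extensional)

lemma gact_closed:
  "\<lbrakk>f \<in> gcarrier (C U) i; v \<in> gcarrier (E U) k\<rbrakk> \<Longrightarrow> gact (E U) i k f v \<in> gcarrier (E U) (i + k)"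
  using EU.gact_linear_right by (rule linear_mapsD(1))

lemma Loc_gact_closed:
  assumes f: "f \<in> gcarrier (C U) i" and F: "F \<in> gcarrier (L U) d"
  shows "gact (L U) i d f F \<in> gcarrier (L U) (i + d)"
proof (rule LocI)
  note cl = Loc_closed[OF F]
  \<comment> \<open>The degree of \<open>f \<cdot> F(\<psi>)\<close>, as a value of \<open>f \<cdot> F\<close> and as a product.\<close>
  have deg: "k + (i + d) = i + (k + d)" for k by simp
  note lin = EU.gact_linear_right[OF f]
  fix k \<psi> assume \<psi>: "\<psi> \<in> gcarrier (E U) k"
  show "gact (L U) i d f F k \<psi> \<in> gcarrier (E U) (k + (i + d))"
    unfolding deg using \<psi> cl f by (simp add: Loc_gact_apply gact_closed)
  show "gact (L U) i d f F k (a \<odot>\<^bsub>part (E U) k\<^esub> \<psi>) =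
      a \<odot>\<^bsub>part (E U) (k + (i + d))\<^esub> gact (L U) i d f F k \<psi>" for a
    unfolding deg using \<psi> cl
    by (simp add: Loc_gact_apply EU.smult_closed Loc_smult[OF F] linear_mapsD(3)[OF lin])
  show "gact (L U) i d f F k (\<psi> \<oplus>\<^bsub>part (E U) k\<^esub> \<phi>) =
      gact (L U) i d f F k \<psi> \<oplus>\<^bsub>part (E U) (k + (i + d))\<^esub> gact (L U) i d f F k \<phi>"
    if "\<phi> \<in> gcarrier (E U) k" for \<phi>
    unfolding deg using \<psi> that cl
    by (simp add: Loc_gact_apply EU.add_closed Loc_add[OF F] linear_mapsD(2)[OF lin])
  show "\<sigma> U V (k + (i + d)) (gact (L U) i d f F k \<psi>) = \<zero>\<^bsub>part (E V) (k + (i + d))\<^esub>"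
    if V: "openin M V" "V \<subseteq> U" "\<sigma> U V k \<psi> = \<zero>\<^bsub>part (E V) k\<^esub>" for V
  proof -
    have "\<rho> U V i f \<in> gcarrier (C V) i" using C.res_closed[OF U V(1,2) f] .
    from linear_maps_zero[OF sections_abelian_group[OF V(1)] sections_abelian_group[OF V(1)]
        graded_module.gact_linear_right[OF modules[OF V(1)] this]]
    show ?thesis
      unfolding deg using \<psi> LocD(3)[OF F \<psi> V] res_gact[OF U V(1,2) f cl[OF \<psi>]]
      by (simp add: Loc_gact_apply)
  qed
qed (rule Loc_extensional)

lemma Loc_graded_vector_space: "graded_vector_space (L U)"
proof (rule graded_vector_space.intro)
  fix d
  let ?P = "part (L U) d"
  note closed = Loc_zero_closed Loc_add_closed Loc_smult_closed
  note app = Loc_zero_apply Loc_add_apply Loc_smult_apply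
  show "module real_field ?P"
  proof (rule moduleI)
    show "cring real_field" using EU.part_module by (rule module.axioms(1))
    show "abelian_group ?P"
    proof (rule abelian_groupI)
      show "F \<oplus>\<^bsub>?P\<^esub> G \<in> carrier ?P" if "F \<in> carrier ?P" "G \<in> carrier ?P" for F G
        using that by (rule Loc_add_closed)
      show "\<zero>\<^bsub>?P\<^esub> \<in> carrier ?P" by (rule Loc_zero_closed)
      show "(F \<oplus>\<^bsub>?P\<^esub> G) \<oplus>\<^bsub>?P\<^esub> H = F \<oplus>\<^bsub>?P\<^esub> (G \<oplus>\<^bsub>?P\<^esub> H)"
        if "F \<in> carrier ?P" "G \<in> carrier ?P" "H \<in> carrier ?P" for F G H
        by (rule Loc_eqI[where U = U and d = d]) (simp_all add: that closed app EU.add_assoc Loc_closed[OF that(1)]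
            Loc_closed[OF that(2)] Loc_closed[OF that(3)])
      show "F \<oplus>\<^bsub>?P\<^esub> G = G \<oplus>\<^bsub>?P\<^esub> F" if "F \<in> carrier ?P" "G \<in> carrier ?P" for F G
        by (rule Loc_eqI[where U = U and d = d]) (simp_all add: that closed app EU.add_commute Loc_closed[OF that(1)]
            Loc_closed[OF that(2)])
      show "\<zero>\<^bsub>?P\<^esub> \<oplus>\<^bsub>?P\<^esub> F = F" if "F \<in> carrier ?P" for F
        by (rule Loc_eqI[where U = U and d = d]) (simp_all add: that closed app EU.add_zero_left Loc_closed[OF that])
      show "\<exists>G\<in>carrier ?P. G \<oplus>\<^bsub>?P\<^esub> F = \<zero>\<^bsub>?P\<^esub>" if "F \<in> carrier ?P" for F
      proof
        show "(- 1) \<odot>\<^bsub>?P\<^esub> F \<in> carrier ?P" using that by (rule Loc_smult_closed)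
        then show "(- 1) \<odot>\<^bsub>?P\<^esub> F \<oplus>\<^bsub>?P\<^esub> F = \<zero>\<^bsub>?P\<^esub>"
          by (intro Loc_eqI[where U = U and d = d]) (simp_all add: that closed app EU.smult_minus_one Loc_closed[OF that])
      qed
    qed
    fix a b :: real and F assume F: "F \<in> carrier ?P"
    show "a \<odot>\<^bsub>?P\<^esub> F \<in> carrier ?P" using F by (rule Loc_smult_closed)
    show "(a \<oplus>\<^bsub>real_field\<^esub> b) \<odot>\<^bsub>?P\<^esub> F = a \<odot>\<^bsub>?P\<^esub> F \<oplus>\<^bsub>?P\<^esub> b \<odot>\<^bsub>?P\<^esub> F"
      by (rule Loc_eqI[where U = U and d = d]) (simp_all add: ring_of_type_algebra_def F closed app EU.smult_add_left Loc_closed[OF F])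
    show "a \<odot>\<^bsub>?P\<^esub> (F \<oplus>\<^bsub>?P\<^esub> G) = a \<odot>\<^bsub>?P\<^esub> F \<oplus>\<^bsub>?P\<^esub> a \<odot>\<^bsub>?P\<^esub> G"
      if G: "G \<in> carrier ?P" for G
      by (rule Loc_eqI[where U = U and d = d]) (simp_all add: F G closed app EU.smult_add_right Loc_closed[OF F] Loc_closed[OF G])
    show "(a \<otimes>\<^bsub>real_field\<^esub> b) \<odot>\<^bsub>?P\<^esub> F = a \<odot>\<^bsub>?P\<^esub> (b \<odot>\<^bsub>?P\<^esub> F)"
      by (rule Loc_eqI[where U = U and d = d]) (simp_all add: ring_of_type_algebra_def F closed app EU.smult_smult Loc_closed[OF F])
    show "\<one>\<^bsub>real_field\<^esub> \<odot>\<^bsub>?P\<^esub> F = F"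
      by (rule Loc_eqI[where U = U and d = d]) (simp_all add: ring_of_type_algebra_def F closed app EU.smult_1 Loc_closed[OF F])
  qed
qed

lemma Loc_graded_module: "graded_module (C U) (L U)"
proof (intro graded_module.intro graded_module_axioms.intro C.algebras U Loc_graded_vector_space)
  note closed = Loc_gact_closed Loc_add_closed Loc_smult_closed
  note app = Loc_gact_apply Loc_add_apply Loc_smult_apply
  have deg: "k + (i + d) = i + (k + d)" for k i d :: int by simp
  show "gact (L U) i d f \<in> linear_maps (part (L U) d) (part (L U) (i + d))"
    if f: "f \<in> gcarrier (C U) i" for f i d
  proof -
    note lin = EU.gact_linear_right[OF f]
    have "gact (L U) i d f (F \<oplus>\<^bsub>part (L U) d\<^esub> G) =
        gact (L U) i d f F \<oplus>\<^bsub>part (L U) (i + d)\<^esub> gact (L U) i d f G"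
      if "F \<in> gcarrier (L U) d" "G \<in> gcarrier (L U) d" for F G
      by (rule Loc_eqI[where U = U and d = "i + d"]) (simp_all add: f that closed app deg linear_mapsD(2)[OF lin]
          Loc_closed[OF that(1)] Loc_closed[OF that(2)])
    moreover have "gact (L U) i d f (c \<odot>\<^bsub>part (L U) d\<^esub> F) = c \<odot>\<^bsub>part (L U) (i + d)\<^esub> gact (L U) i d f F"
      if "F \<in> gcarrier (L U) d" for c F
      by (rule Loc_eqI[where U = U and d = "i + d"]) (simp_all add: f that closed app deg linear_mapsD(3)[OF lin] Loc_closed[OF that])
    ultimately show ?thesis using f by (simp add: linear_maps_def Loc_gact_closed)
  qed
  show "(\<lambda>f. gact (L U) i d f F) \<in> linear_maps (part (C U) i) (part (L U) (i + d))"
    if F: "F \<in> gcarrier (L U) d" for F i d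
  proof -
    note lin = EU.gact_linear_left[OF Loc_closed[OF F]]
    have "gact (L U) i d (f \<oplus>\<^bsub>part (C U) i\<^esub> g) F =
        gact (L U) i d f F \<oplus>\<^bsub>part (L U) (i + d)\<^esub> gact (L U) i d g F"
      if "f \<in> gcarrier (C U) i" "g \<in> gcarrier (C U) i" for f g
      by (rule Loc_eqI[where U = U and d = "i + d"]) (simp_all add: F that EU.A.add_closed closed app deg linear_mapsD(2)[OF lin])
    moreover have "gact (L U) i d (c \<odot>\<^bsub>part (C U) i\<^esub> f) F = c \<odot>\<^bsub>part (L U) (i + d)\<^esub> gact (L U) i d f F"
      if "f \<in> gcarrier (C U) i" for c f
      by (rule Loc_eqI[where U = U and d = "i + d"]) (simp_all add: F that EU.A.smult_closed closed app deg linear_mapsD(3)[OF lin])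
    ultimately show ?thesis using F by (simp add: linear_maps_def Loc_gact_closed)
  qed
  show "gact (L U) (i + j) d (gmult (C U) i j f g) F = gact (L U) i (j + d) f (gact (L U) j d g F)"
    if f: "f \<in> gcarrier (C U) i" and g: "g \<in> gcarrier (C U) j" and F: "F \<in> gcarrier (L U) d" for f i g j F d
  proof (rule Loc_eqI[where U = U and d = "i + (j + d)"])
    have "gmult (C U) i j f g \<in> gcarrier (C U) (i + j)"
      using EU.A.gmult_linear_right[OF f] g by (rule linear_mapsD(1))
    from Loc_gact_closed[OF this F]
    show "gact (L U) (i + j) d (gmult (C U) i j f g) F \<in> gcarrier (L U) (i + (j + d))"
      by (simp only: add.assoc)
    show "gact (L U) i (j + d) f (gact (L U) j d g F) \<in> gcarrier (L U) (i + (j + d))"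
      by (intro Loc_gact_closed f g F)
    show "gact (L U) (i + j) d (gmult (C U) i j f g) F k \<psi> = gact (L U) i (j + d) f (gact (L U) j d g F) k \<psi>"
      if "\<psi> \<in> gcarrier (E U) k" for k \<psi>
      using EU.gact_assoc[OF f g Loc_closed[OF F that]] that by (simp add: Loc_gact_apply deg)
  qed
  show "gact (L U) 0 d (gone (C U)) F = F" if F: "F \<in> gcarrier (L U) d" for F d
    by (rule Loc_eqI[where U = U and d = d])
       (use Loc_gact_closed[OF EU.A.gone_closed F] F EU.gact_one Loc_closed[OF F] in \<open>simp_all add: Loc_gact_apply\<close>)
qed

end

end


section \<open>Restriction of local operators\<close>

text \<open>The compatibility \<open>F(\<psi>)|\<^sub>V = F'(\<psi>|\<^sub>V)\<close> that characterizes \<open>F|\<^sub>V\<close> among the local operators over \<open>V\<close>.\<close>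

definition (in graded_sheaf) is_restriction ::
  "'p set \<Rightarrow> 'p set \<Rightarrow> int \<Rightarrow> (int \<Rightarrow> 'v \<Rightarrow> 'v) \<Rightarrow> (int \<Rightarrow> 'v \<Rightarrow> 'v) \<Rightarrow> bool"
  where "is_restriction U V d F F' \<longleftrightarrow>
    (\<forall>k. \<forall>\<psi> \<in> gcarrier (G U) k. \<rho> U V (k + d) (F k \<psi>) = F' k (\<rho> U V k \<psi>))"

text \<open>
  The remaining arguments apply to every sheaf of graded modules over a sheaf of graded algebras
  that has enough bump functions. The bump functions are global sections; their restrictions serve
  all open sets.
\<close>

locale sheaf_of_graded_modules_with_bumps = sheaf_of_graded_modules +
  assumes bump: "\<lbrakk>openin M V; x \<in> V\<rbrakk> \<Longrightarrow>
    \<exists>f A N. f \<in> gcarrier (C (topspace M)) 0 \<and> closedin M A \<and> A \<subseteq> V \<and>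
      openin M N \<and> x \<in> N \<and> N \<subseteq> A \<and>
      \<rho> (topspace M) N 0 f = gone (C N) \<and>
      \<rho> (topspace M) (topspace M - A) 0 f = \<zero>\<^bsub>part (C (topspace M - A)) 0\<^esub>"
begin

text \<open>
  Multiplication by a bump function extends a section, after shrinking the open set around a given
  point, to a larger open set.
\<close>

lemma extend_germ:
  assumes U: "openin M U" and V: "openin M V" "V \<subseteq> U" and x: "x \<in> V"
    and \<psi>: "\<psi> \<in> gcarrier (E V) k"
  obtains N \<phi> where "openin M N" "x \<in> N" "N \<subseteq> V" "\<phi> \<in> gcarrier (E U) k" "\<sigma> U N k \<phi> = \<sigma> V N k \<psi>"
proof -
  obtain f A N where f: "f \<in> gcarrier (C (topspace M)) 0"
    and A: "closedin M A" "A \<subseteq> V" and N: "openin M N" "x \<in> N" "N \<subseteq> A"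
    and f_one: "\<rho> (topspace M) N 0 f = gone (C N)"
    and f_zero: "\<rho> (topspace M) (topspace M - A) 0 f = \<zero>\<^bsub>part (C (topspace M - A)) 0\<^esub>"
    using bump[OF V(1) x] by blast
  have NV: "N \<subseteq> V" and VM: "V \<subseteq> topspace M" and VA: "openin M (V - A)" and MA: "openin M (topspace M - A)"
    using A N openin_subset[OF V(1)] V(1) by auto
  define g where "g = \<rho> (topspace M) V 0 f"
  define s where "s = gact (E V) 0 k g \<psi>"
  have g: "g \<in> gcarrier (C V) 0"
    unfolding g_def by (rule C.res_closed[OF openin_topspace V(1) VM f])
  have g_one: "\<rho> V N 0 g = gone (C N)"
    unfolding g_def using C.res_comp[OF openin_topspace V(1) N(1) NV VM f] f_one by simp
  have g_zero: "\<rho> V (V - A) 0 g = \<zero>\<^bsub>part (C (V - A)) 0\<^esub>"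
  proof -
    have sub: "V - A \<subseteq> topspace M - A" using VM by blast
    have "\<rho> V (V - A) 0 g = \<rho> (topspace M) (V - A) 0 f"
      unfolding g_def by (rule C.res_comp[OF openin_topspace V(1) VA Diff_subset VM f])
    also have "\<dots> = \<rho> (topspace M - A) (V - A) 0 (\<rho> (topspace M) (topspace M - A) 0 f)"
      by (rule C.res_comp[OF openin_topspace MA VA sub Diff_subset f, symmetric])
    finally show ?thesis
      unfolding f_zero by (simp add: C.res_zero[OF MA VA sub])
  qed
  have s: "s \<in> gcarrier (E V) k"
    unfolding s_def using gact_closed[OF V(1) g \<psi>] by simp
  have s_res: "\<sigma> V W k s = gact (E W) 0 k (\<rho> V W 0 g) (\<sigma> V W k \<psi>)" if "openin M W" "W \<subseteq> V" for W
    unfolding s_def using res_gact[OF V(1) that g \<psi>] by simp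
  have "\<sigma> V (V - A) k s = \<zero>\<^bsub>part (E (V - A)) k\<^esub>"
    using s_res[OF VA Diff_subset]
      linear_maps_zero[OF C.sections_abelian_group[OF VA] sections_abelian_group[OF VA]
        graded_module.gact_linear_left[OF modules[OF VA] res_closed[OF V(1) VA Diff_subset \<psi>]], of 0]
    by (simp add: g_zero)
  then obtain \<phi> where \<phi>: "\<phi> \<in> gcarrier (E U) k" "\<sigma> U V k \<phi> = s"
    using extend_by_zero[OF U V A s] by blast
  have "\<sigma> U N k \<phi> = \<sigma> V N k s"
    using res_comp[OF U V(1) N(1) NV V(2) \<phi>(1)] \<phi>(2) by simp
  also have "\<dots> = \<sigma> V N k \<psi>"
    unfolding s_res[OF N(1) NV] g_one
    by (rule graded_module.gact_one[OF modules[OF N(1)] res_closed[OF V(1) N(1) NV \<psi>]])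
  finally show thesis using that N NV \<phi>(1) by blast
qed

lemma restriction_unique:
  assumes op: "openin M U" "openin M V" "V \<subseteq> U"
    and G: "G \<in> gcarrier (L V) d" "is_restriction U V d F G"
    and H: "H \<in> gcarrier (L V) d" "is_restriction U V d F H"
  shows "G = H"
proof (rule Loc_eqI[OF G(1) H(1)])
  fix k \<psi> assume \<psi>: "\<psi> \<in> gcarrier (E V) k"
  show "G k \<psi> = H k \<psi>"
  proof (rule sections_eqI[OF op(2) Loc_closed[OF G(1) \<psi>] Loc_closed[OF H(1) \<psi>]])
    fix x assume "x \<in> V"
    obtain N \<phi> where N: "openin M N" "x \<in> N" "N \<subseteq> V" and \<phi>: "\<phi> \<in> gcarrier (E U) k"
      and eq: "\<sigma> U N k \<phi> = \<sigma> V N k \<psi>"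
      using extend_germ[OF op \<open>x \<in> V\<close> \<psi>] .
    have \<phi>V: "\<sigma> U V k \<phi> \<in> gcarrier (E V) k" by (rule res_closed[OF op \<phi>])
    have eq': "\<sigma> V N k \<psi> = \<sigma> V N k (\<sigma> U V k \<phi>)"
      using eq res_comp[OF op(1,2) N(1,3) op(3) \<phi>] by simp
    have "\<sigma> V N (k + d) (G k \<psi>) = \<sigma> V N (k + d) (H k \<psi>)"
      using Loc_res_cong[OF G(1) op(2) N(1,3) \<psi> \<phi>V eq'] Loc_res_cong[OF H(1) op(2) N(1,3) \<psi> \<phi>V eq']
        G(2) H(2) \<phi> unfolding is_restriction_def by metis
    with N show "\<exists>N. openin M N \<and> x \<in> N \<and> N \<subseteq> V \<and> \<sigma> V N (k + d) (G k \<psi>) = \<sigma> V N (k + d) (H k \<psi>)"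
      by blast
  qed
qed

text \<open>
  The value of \<open>F|\<^sub>V\<close> at a section \<open>\<psi>\<close> over \<open>V\<close>: over every open set \<open>N\<close> on which \<open>\<psi>\<close> agrees with a section
  \<open>\<phi>\<close> over \<open>U\<close> it has to be \<open>F(\<phi>)\<close>. By locality this does not depend on \<open>\<phi>\<close>, and such sets \<open>N\<close> cover \<open>V\<close>.
\<close>

lemma glue_local_values:
  assumes op: "openin M U" "openin M V" "V \<subseteq> U" and F: "F \<in> gcarrier (L U) d"
    and \<psi>: "\<psi> \<in> gcarrier (E V) k"
  shows "\<exists>s \<in> gcarrier (E V) (k + d). \<forall>N \<phi>. openin M N \<and> N \<subseteq> V \<and> \<phi> \<in> gcarrier (E U) k \<and>
      \<sigma> U N k \<phi> = \<sigma> V N k \<psi> \<longrightarrow> \<sigma> V N (k + d) s = \<sigma> U N (k + d) (F k \<phi>)"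
proof -
  define \<U> where "\<U> = {N. openin M N \<and> N \<subseteq> V \<and> (\<exists>\<phi> \<in> gcarrier (E U) k. \<sigma> U N k \<phi> = \<sigma> V N k \<psi>)}"
  have "\<forall>N\<in>\<U>. \<exists>\<phi>. \<phi> \<in> gcarrier (E U) k \<and> \<sigma> U N k \<phi> = \<sigma> V N k \<psi>"
    by (auto simp: \<U>_def)
  then obtain e where "\<forall>N\<in>\<U>. e N \<in> gcarrier (E U) k \<and> \<sigma> U N k (e N) = \<sigma> V N k \<psi>"
    unfolding bchoice_iff by blast
  then have e: "e N \<in> gcarrier (E U) k" "\<sigma> U N k (e N) = \<sigma> V N k \<psi>" if "N \<in> \<U>" for N
    using that by blast+
  have V: "\<Union>\<U> = V"
  proof
    show "V \<subseteq> \<Union>\<U>"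
    proof
      fix x assume "x \<in> V"
      obtain N \<phi> where "openin M N" "x \<in> N" "N \<subseteq> V" "\<phi> \<in> gcarrier (E U) k" "\<sigma> U N k \<phi> = \<sigma> V N k \<psi>"
        using extend_germ[OF op \<open>x \<in> V\<close> \<psi>] .
      then have "N \<in> \<U>" "x \<in> N" unfolding \<U>_def by auto
      then show "x \<in> \<Union>\<U>" by (rule UnionI)
    qed
  qed (auto simp: \<U>_def)
  have "\<exists>!s. s \<in> gcarrier (E (\<Union>\<U>)) (k + d) \<and>
      (\<forall>N \<in> \<U>. \<sigma> (\<Union>\<U>) N (k + d) s = \<sigma> U N (k + d) (F k (e N)))"
  proof (rule gluing)
    fix N N' assume NN: "N \<in> \<U>" "N' \<in> \<U>"
    then have N: "openin M N" "N \<subseteq> V" "N \<subseteq> U" and N': "openin M N'" "N' \<subseteq> V" "N' \<subseteq> U"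
      using op(3) by (auto simp: \<U>_def)
    have I: "openin M (N \<inter> N')" "N \<inter> N' \<subseteq> U" using N N' by auto
    show "openin M N" by fact
    show "\<sigma> U N (k + d) (F k (e N)) \<in> gcarrier (E N) (k + d)"
      by (rule res_closed[OF op(1) N(1,3) Loc_closed[OF F e(1)[OF NN(1)]]])
    have "\<sigma> U (N \<inter> N') k (e N) = \<sigma> V (N \<inter> N') k \<psi>"
      using res_agree_mono[OF op(1,2) N(1) I(1) N(3,2) Int_lower1 e(1)[OF NN(1)] \<psi> e(2)[OF NN(1)]] .
    also have "\<dots> = \<sigma> U (N \<inter> N') k (e N')"
      using res_agree_mono[OF op(1,2) N'(1) I(1) N'(3,2) Int_lower2 e(1)[OF NN(2)] \<psi> e(2)[OF NN(2)]] ..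
    finally have "\<sigma> U (N \<inter> N') (k + d) (F k (e N)) = \<sigma> U (N \<inter> N') (k + d) (F k (e N'))"
      by (rule Loc_res_cong[OF F op(1) I e(1)[OF NN(1)] e(1)[OF NN(2)]])
    then show "\<sigma> N (N \<inter> N') (k + d) (\<sigma> U N (k + d) (F k (e N))) =
        \<sigma> N' (N \<inter> N') (k + d) (\<sigma> U N' (k + d) (F k (e N')))"
      using res_comp[OF op(1) N(1) I(1) Int_lower1 N(3) Loc_closed[OF F e(1)[OF NN(1)]]]
        res_comp[OF op(1) N'(1) I(1) Int_lower2 N'(3) Loc_closed[OF F e(1)[OF NN(2)]]] by simp
  qed
  then obtain s where s: "s \<in> gcarrier (E V) (k + d)"
      "\<And>N. N \<in> \<U> \<Longrightarrow> \<sigma> V N (k + d) s = \<sigma> U N (k + d) (F k (e N))"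
    unfolding V by blast
  have "\<sigma> V N (k + d) s = \<sigma> U N (k + d) (F k \<phi>)"
    if N: "openin M N" "N \<subseteq> V" and \<phi>: "\<phi> \<in> gcarrier (E U) k" "\<sigma> U N k \<phi> = \<sigma> V N k \<psi>" for N \<phi>
  proof -
    have NU: "N \<in> \<U>" using N \<phi> by (auto simp: \<U>_def)
    have "N \<subseteq> U" using N(2) op(3) by blast
    have "\<sigma> U N k (e N) = \<sigma> U N k \<phi>" using e(2)[OF NU] \<phi>(2) by simp
    then show ?thesis
      unfolding s(2)[OF NU] by (rule Loc_res_cong[OF F op(1) N(1) \<open>N \<subseteq> U\<close> e(1)[OF NU] \<phi>(1)])
  qed
  with s(1) show ?thesis by blast
qed

lemma restriction_exists:
  assumes op: "openin M U" "openin M V" "V \<subseteq> U" and F: "F \<in> gcarrier (L U) d"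
  obtains G where "G \<in> gcarrier (L V) d" "is_restriction U V d F G"
proof -
  have "\<forall>k. \<forall>\<psi> \<in> gcarrier (E V) k. \<exists>s. s \<in> gcarrier (E V) (k + d) \<and>
      (\<forall>N \<phi>. openin M N \<and> N \<subseteq> V \<and> \<phi> \<in> gcarrier (E U) k \<and>
        \<sigma> U N k \<phi> = \<sigma> V N k \<psi> \<longrightarrow> \<sigma> V N (k + d) s = \<sigma> U N (k + d) (F k \<phi>))"
    using glue_local_values[OF op F] by blast
  then obtain g where g: "\<forall>k. \<forall>\<psi> \<in> gcarrier (E V) k. g k \<psi> \<in> gcarrier (E V) (k + d) \<and>
      (\<forall>N \<phi>. openin M N \<and> N \<subseteq> V \<and> \<phi> \<in> gcarrier (E U) k \<and>
        \<sigma> U N k \<phi> = \<sigma> V N k \<psi> \<longrightarrow> \<sigma> V N (k + d) (g k \<psi>) = \<sigma> U N (k + d) (F k \<phi>))"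
    unfolding bchoice_iff choice_iff by blast
  define G where "G k = restrict (g k) (gcarrier (E V) k)" for k
  have closed: "G k \<psi> \<in> gcarrier (E V) (k + d)" if "\<psi> \<in> gcarrier (E V) k" for k \<psi>
    using g that by (simp add: G_def)
  have germ: "\<sigma> V N (k + d) (G k \<psi>) = \<sigma> U N (k + d) (F k \<phi>)"
    if "\<psi> \<in> gcarrier (E V) k" "openin M N" "N \<subseteq> V" "\<phi> \<in> gcarrier (E U) k"
      "\<sigma> U N k \<phi> = \<sigma> V N k \<psi>" for k \<psi> N \<phi>
    using g that by (simp add: G_def)
  interpret EU: graded_vector_space "E U" by (rule sections[OF op(1)])
  interpret EV: graded_vector_space "E V" by (rule sections[OF op(2)])
  have "G \<in> gcarrier (L V) d"
  proof (rule LocI)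
    show "G k \<in> extensional (gcarrier (E V) k)" for k by (simp add: G_def)
    fix k \<psi> assume \<psi>: "\<psi> \<in> gcarrier (E V) k"
    show "G k \<psi> \<in> gcarrier (E V) (k + d)" using \<psi> by (rule closed)
    show "G k (\<psi> \<oplus>\<^bsub>part (E V) k\<^esub> \<psi>') = G k \<psi> \<oplus>\<^bsub>part (E V) (k + d)\<^esub> G k \<psi>'"
      if \<psi>': "\<psi>' \<in> gcarrier (E V) k" for \<psi>'
    proof (rule sections_eqI[OF op(2)])
      show "G k (\<psi> \<oplus>\<^bsub>part (E V) k\<^esub> \<psi>') \<in> gcarrier (E V) (k + d)"
        by (intro closed EV.add_closed \<psi> \<psi>')
      show "G k \<psi> \<oplus>\<^bsub>part (E V) (k + d)\<^esub> G k \<psi>' \<in> gcarrier (E V) (k + d)"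
        by (intro closed EV.add_closed \<psi> \<psi>')
      fix x assume x: "x \<in> V"
      obtain N\<^sub>1 \<phi> where 1: "openin M N\<^sub>1" "x \<in> N\<^sub>1" "N\<^sub>1 \<subseteq> V" "\<phi> \<in> gcarrier (E U) k"
          "\<sigma> U N\<^sub>1 k \<phi> = \<sigma> V N\<^sub>1 k \<psi>"
        using extend_germ[OF op x \<psi>] .
      obtain N\<^sub>2 \<phi>' where 2: "openin M N\<^sub>2" "x \<in> N\<^sub>2" "N\<^sub>2 \<subseteq> V" "\<phi>' \<in> gcarrier (E U) k"
          "\<sigma> U N\<^sub>2 k \<phi>' = \<sigma> V N\<^sub>2 k \<psi>'"
        using extend_germ[OF op x \<psi>'] .
      define N where "N = N\<^sub>1 \<inter> N\<^sub>2"
      have N: "openin M N" "x \<in> N" "N \<subseteq> V" "N \<subseteq> U" "N \<subseteq> N\<^sub>1" "N \<subseteq> N\<^sub>2"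
        using 1 2 op(3) by (auto simp: N_def)
      have a1: "\<sigma> U N k \<phi> = \<sigma> V N k \<psi>"
        using res_agree_mono[OF op(1,2) 1(1) N(1) _ 1(3) N(5) 1(4) \<psi> 1(5)] 1(3) op(3) by blast
      have a2: "\<sigma> U N k \<phi>' = \<sigma> V N k \<psi>'"
        using res_agree_mono[OF op(1,2) 2(1) N(1) _ 2(3) N(6) 2(4) \<psi>' 2(5)] 2(3) op(3) by blast
      have "\<sigma> U N k (\<phi> \<oplus>\<^bsub>part (E U) k\<^esub> \<phi>') = \<sigma> V N k (\<psi> \<oplus>\<^bsub>part (E V) k\<^esub> \<psi>')"
        using res_add[OF op(1) N(1,4) 1(4) 2(4)] res_add[OF op(2) N(1,3) \<psi> \<psi>'] a1 a2 by simp
      then have "\<sigma> V N (k + d) (G k (\<psi> \<oplus>\<^bsub>part (E V) k\<^esub> \<psi>')) = \<sigma> U N (k + d) (F k (\<phi> \<oplus>\<^bsub>part (E U) k\<^esub> \<phi>'))"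
        by (intro germ N EV.add_closed EU.add_closed \<psi> \<psi>' 1 2)
      also have "\<dots> = \<sigma> U N (k + d) (F k \<phi>) \<oplus>\<^bsub>part (E N) (k + d)\<^esub> \<sigma> U N (k + d) (F k \<phi>')"
        unfolding Loc_add[OF F 1(4) 2(4)]
        by (rule res_add[OF op(1) N(1,4) Loc_closed[OF F 1(4)] Loc_closed[OF F 2(4)]])
      also have "\<dots> = \<sigma> V N (k + d) (G k \<psi> \<oplus>\<^bsub>part (E V) (k + d)\<^esub> G k \<psi>')"
        using res_add[OF op(2) N(1,3) closed[OF \<psi>] closed[OF \<psi>']]
          germ[OF \<psi> N(1,3) 1(4) a1] germ[OF \<psi>' N(1,3) 2(4) a2] by simp
      finally show "\<exists>N. openin M N \<and> x \<in> N \<and> N \<subseteq> V \<and>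
          \<sigma> V N (k + d) (G k (\<psi> \<oplus>\<^bsub>part (E V) k\<^esub> \<psi>')) =
          \<sigma> V N (k + d) (G k \<psi> \<oplus>\<^bsub>part (E V) (k + d)\<^esub> G k \<psi>')"
        using N by blast
    qed
    show "G k (c \<odot>\<^bsub>part (E V) k\<^esub> \<psi>) = c \<odot>\<^bsub>part (E V) (k + d)\<^esub> G k \<psi>" for c
    proof (rule sections_eqI[OF op(2)])
      show "G k (c \<odot>\<^bsub>part (E V) k\<^esub> \<psi>) \<in> gcarrier (E V) (k + d)"
        by (intro closed EV.smult_closed \<psi>)
      show "c \<odot>\<^bsub>part (E V) (k + d)\<^esub> G k \<psi> \<in> gcarrier (E V) (k + d)"
        by (intro closed EV.smult_closed \<psi>)
      fix x assume x: "x \<in> V"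
      obtain N \<phi> where N: "openin M N" "x \<in> N" "N \<subseteq> V" and \<phi>: "\<phi> \<in> gcarrier (E U) k"
          and eq: "\<sigma> U N k \<phi> = \<sigma> V N k \<psi>"
        using extend_germ[OF op x \<psi>] .
      have NU: "N \<subseteq> U" using N(3) op(3) by blast
      have "\<sigma> U N k (c \<odot>\<^bsub>part (E U) k\<^esub> \<phi>) = \<sigma> V N k (c \<odot>\<^bsub>part (E V) k\<^esub> \<psi>)"
        using res_smult[OF op(1) N(1) NU \<phi>] res_smult[OF op(2) N(1,3) \<psi>] eq by simp
      then have "\<sigma> V N (k + d) (G k (c \<odot>\<^bsub>part (E V) k\<^esub> \<psi>)) = \<sigma> U N (k + d) (F k (c \<odot>\<^bsub>part (E U) k\<^esub> \<phi>))"
        by (intro germ N EV.smult_closed EU.smult_closed \<psi> \<phi>)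
      also have "\<dots> = c \<odot>\<^bsub>part (E N) (k + d)\<^esub> \<sigma> U N (k + d) (F k \<phi>)"
        unfolding Loc_smult[OF F \<phi>] by (rule res_smult[OF op(1) N(1) NU Loc_closed[OF F \<phi>]])
      also have "\<dots> = \<sigma> V N (k + d) (c \<odot>\<^bsub>part (E V) (k + d)\<^esub> G k \<psi>)"
        using res_smult[OF op(2) N(1,3) closed[OF \<psi>]] germ[OF \<psi> N(1,3) \<phi> eq] by simp
      finally show "\<exists>N. openin M N \<and> x \<in> N \<and> N \<subseteq> V \<and>
          \<sigma> V N (k + d) (G k (c \<odot>\<^bsub>part (E V) k\<^esub> \<psi>)) = \<sigma> V N (k + d) (c \<odot>\<^bsub>part (E V) (k + d)\<^esub> G k \<psi>)"
        using N by blast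
    qed
    show "\<sigma> V W (k + d) (G k \<psi>) = \<zero>\<^bsub>part (E W) (k + d)\<^esub>"
      if W: "openin M W" "W \<subseteq> V" "\<sigma> V W k \<psi> = \<zero>\<^bsub>part (E W) k\<^esub>" for W
    proof (rule sections_eqI[OF W(1) res_closed[OF op(2) W(1,2) closed[OF \<psi>]] zero_section[OF W(1)]])
      fix x assume x: "x \<in> W"
      then have "x \<in> V" using W(2) by blast
      obtain N' \<phi> where N': "openin M N'" "x \<in> N'" "N' \<subseteq> V" and \<phi>: "\<phi> \<in> gcarrier (E U) k"
          and eq': "\<sigma> U N' k \<phi> = \<sigma> V N' k \<psi>"
        using extend_germ[OF op \<open>x \<in> V\<close> \<psi>] .
      define N where "N = N' \<inter> W"
      have N: "openin M N" "x \<in> N" "N \<subseteq> V" "N \<subseteq> U" "N \<subseteq> N'" "N \<subseteq> W" "N' \<subseteq> U"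
        using N' W x op(3) by (auto simp: N_def)
      have eq: "\<sigma> U N k \<phi> = \<sigma> V N k \<psi>"
        by (rule res_agree_mono[OF op(1,2) N'(1) N(1,7) N'(3) N(5) \<phi> \<psi> eq'])
      also have "\<dots> = \<zero>\<^bsub>part (E N) k\<^esub>"
        using res_comp[OF op(2) W(1) N(1,6) W(2) \<psi>] W(3) res_zero[OF W(1) N(1,6)] by simp
      finally have "\<sigma> U N (k + d) (F k \<phi>) = \<zero>\<^bsub>part (E N) (k + d)\<^esub>"
        by (rule LocD(3)[OF F \<phi> N(1,4)])
      then have "\<sigma> W N (k + d) (\<sigma> V W (k + d) (G k \<psi>)) = \<sigma> W N (k + d) \<zero>\<^bsub>part (E W) (k + d)\<^esub>"
        using res_comp[OF op(2) W(1) N(1,6) W(2) closed[OF \<psi>]] germ[OF \<psi> N(1,3) \<phi> eq]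
          res_zero[OF W(1) N(1,6)] by simp
      with N show "\<exists>N. openin M N \<and> x \<in> N \<and> N \<subseteq> W \<and>
          \<sigma> W N (k + d) (\<sigma> V W (k + d) (G k \<psi>)) = \<sigma> W N (k + d) \<zero>\<^bsub>part (E W) (k + d)\<^esub>"
        by blast
    qed
  qed
  moreover have "is_restriction U V d F G"
    unfolding is_restriction_def
  proof (intro allI ballI)
    fix k \<psi> assume \<psi>: "\<psi> \<in> gcarrier (E U) k"
    have \<psi>V: "\<sigma> U V k \<psi> \<in> gcarrier (E V) k" by (rule res_closed[OF op \<psi>])
    have "\<sigma> V V (k + d) (G k (\<sigma> U V k \<psi>)) = \<sigma> U V (k + d) (F k \<psi>)"
      by (rule germ[OF \<psi>V op(2) subset_refl \<psi>]) (simp add: res_id[OF op(2) \<psi>V])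
    then show "\<sigma> U V (k + d) (F k \<psi>) = G k (\<sigma> U V k \<psi>)"
      by (simp add: res_id[OF op(2) closed[OF \<psi>V]])
  qed
  ultimately show thesis by (rule that)
qed


section \<open>The sheaf of local operators\<close>

abbreviation "r \<equiv> loc_res M E \<sigma>"

lemma loc_res_eqI:
  assumes "openin M U" "openin M V" "V \<subseteq> U" "G \<in> gcarrier (L V) d" "is_restriction U V d F G"
  shows "r U V d F = G"
  unfolding loc_res_def
  using assms restriction_unique[OF assms(1-3)] unfolding is_restriction_def
  by (intro the_equality) blast+

lemma
  assumes "openin M U" "openin M V" "V \<subseteq> U" "F \<in> gcarrier (L U) d"
  shows loc_res_closed: "r U V d F \<in> gcarrier (L V) d"
    and loc_res_apply: "\<psi> \<in> gcarrier (E U) k \<Longrightarrow> r U V d F k (\<sigma> U V k \<psi>) = \<sigma> U V (k + d) (F k \<psi>)"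
proof -
  obtain G where "G \<in> gcarrier (L V) d" "is_restriction U V d F G"
    by (rule restriction_exists[OF assms])
  moreover from this have "r U V d F = G" by (rule loc_res_eqI[OF assms(1-3)])
  ultimately show "r U V d F \<in> gcarrier (L V) d"
    and "\<psi> \<in> gcarrier (E U) k \<Longrightarrow> r U V d F k (\<sigma> U V k \<psi>) = \<sigma> U V (k + d) (F k \<psi>)"
    by (simp_all add: is_restriction_def)
qed

lemma loc_res_linear:
  assumes op: "openin M U" "openin M V" "V \<subseteq> U"
  shows "graded_linear (L U) (L V) 0 (r U V)"
proof -
  have "r U V d (F \<oplus>\<^bsub>part (L U) d\<^esub> G) = r U V d F \<oplus>\<^bsub>part (L V) d\<^esub> r U V d G"
    if F: "F \<in> gcarrier (L U) d" and G: "G \<in> gcarrier (L U) d" for d F G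
  proof (rule loc_res_eqI[OF op])
    show "r U V d F \<oplus>\<^bsub>part (L V) d\<^esub> r U V d G \<in> gcarrier (L V) d"
      by (intro Loc_add_closed loc_res_closed op F G)
    show "is_restriction U V d (F \<oplus>\<^bsub>part (L U) d\<^esub> G) (r U V d F \<oplus>\<^bsub>part (L V) d\<^esub> r U V d G)"
      unfolding is_restriction_def
      by (simp add: Loc_add_apply res_closed[OF op] loc_res_apply[OF op F] loc_res_apply[OF op G]
          res_add[OF op] Loc_closed[OF F] Loc_closed[OF G])
  qed
  moreover have "r U V d (c \<odot>\<^bsub>part (L U) d\<^esub> F) = c \<odot>\<^bsub>part (L V) d\<^esub> r U V d F"
    if F: "F \<in> gcarrier (L U) d" for d c F
  proof (rule loc_res_eqI[OF op])
    show "c \<odot>\<^bsub>part (L V) d\<^esub> r U V d F \<in> gcarrier (L V) d"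
      by (intro Loc_smult_closed loc_res_closed op F)
    show "is_restriction U V d (c \<odot>\<^bsub>part (L U) d\<^esub> F) (c \<odot>\<^bsub>part (L V) d\<^esub> r U V d F)"
      unfolding is_restriction_def
      by (simp add: Loc_smult_apply res_closed[OF op] loc_res_apply[OF op F] res_smult[OF op] Loc_closed[OF F])
  qed
  ultimately show ?thesis
    by (simp add: graded_linear_def linear_maps_def loc_res_closed[OF op])
qed

lemma loc_res_id:
  assumes U: "openin M U" and F: "F \<in> gcarrier (L U) d"
  shows "r U U d F = F"
  by (rule loc_res_eqI[OF U U subset_refl F])
     (simp add: is_restriction_def res_id[OF U] Loc_closed[OF F])

lemma loc_res_comp:
  assumes U: "openin M U" and V: "openin M V" and W: "openin M W" and sub: "W \<subseteq> V" "V \<subseteq> U"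
    and F: "F \<in> gcarrier (L U) d"
  shows "r V W d (r U V d F) = r U W d F"
proof (rule sym, rule loc_res_eqI)
  have FV: "r U V d F \<in> gcarrier (L V) d" by (rule loc_res_closed[OF U V sub(2) F])
  show "openin M U" "openin M W" "W \<subseteq> U" using U W sub by auto
  show "r V W d (r U V d F) \<in> gcarrier (L W) d" by (rule loc_res_closed[OF V W sub(1) FV])
  show "is_restriction U W d F (r V W d (r U V d F))"
    unfolding is_restriction_def
  proof (intro allI ballI)
    fix k \<psi> assume \<psi>: "\<psi> \<in> gcarrier (E U) k"
    show "\<sigma> U W (k + d) (F k \<psi>) = r V W d (r U V d F) k (\<sigma> U W k \<psi>)"
      using loc_res_apply[OF V W sub(1) FV res_closed[OF U V sub(2) \<psi>]]
        loc_res_apply[OF U V sub(2) F \<psi>] res_comp[OF U V W sub \<psi>]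
        res_comp[OF U V W sub Loc_closed[OF F \<psi>]] by simp
  qed
qed

lemma loc_res_gact:
  assumes op: "openin M U" "openin M V" "V \<subseteq> U"
    and f: "f \<in> gcarrier (C U) i" and F: "F \<in> gcarrier (L U) d"
  shows "r U V (i + d) (gact (L U) i d f F) = gact (L V) i d (\<rho> U V i f) (r U V d F)"
proof (rule loc_res_eqI[OF op])
  show "gact (L V) i d (\<rho> U V i f) (r U V d F) \<in> gcarrier (L V) (i + d)"
    by (intro Loc_gact_closed loc_res_closed op F C.res_closed f)
  have deg: "k + (i + d) = i + (k + d)" for k by simp
  show "is_restriction U V (i + d) (gact (L U) i d f F) (gact (L V) i d (\<rho> U V i f) (r U V d F))"
    unfolding is_restriction_def deg
    by (simp add: Loc_gact_apply res_closed[OF op] loc_res_apply[OF op F] res_gact[OF op f] Loc_closed[OF F])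
qed

text \<open>
  The glued operator \<open>F\<close> sends \<open>\<psi>\<close> to the section that restricts to \<open>t V (\<psi>|\<^sub>V)\<close> over every member \<open>V\<close> of
  the cover.
\<close>

lemma Loc_gluing:
  assumes op: "\<And>V. V \<in> \<U> \<Longrightarrow> openin M V"
    and t: "\<And>V. V \<in> \<U> \<Longrightarrow> t V \<in> gcarrier (L V) d"
    and compat: "\<And>V W. \<lbrakk>V \<in> \<U>; W \<in> \<U>\<rbrakk> \<Longrightarrow> r V (V \<inter> W) d (t V) = r W (V \<inter> W) d (t W)"
  shows "\<exists>!F. F \<in> gcarrier (L (\<Union>\<U>)) d \<and> (\<forall>V \<in> \<U>. r (\<Union>\<U>) V d F = t V)"
proof -
  define U where "U = \<Union>\<U>"
  have U: "openin M U" and sub: "\<And>V. V \<in> \<U> \<Longrightarrow> V \<subseteq> U"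
    using op by (auto simp: U_def)
  interpret EU: graded_vector_space "E U" by (rule sections[OF U])
  have eqI: "s = s'" if "s \<in> gcarrier (E U) k" "s' \<in> gcarrier (E U) k"
    "\<And>V. V \<in> \<U> \<Longrightarrow> \<sigma> U V k s = \<sigma> U V k s'" for s s' k
    using that(3) op sub by (intro sections_eqI[OF U that(1,2)]) (auto simp: U_def)
  have "\<exists>s. s \<in> gcarrier (E U) (k + d) \<and> (\<forall>V \<in> \<U>. \<sigma> U V (k + d) s = t V k (\<sigma> U V k \<psi>))"
    if \<psi>: "\<psi> \<in> gcarrier (E U) k" for k \<psi>
  proof -
    have "\<exists>!s. s \<in> gcarrier (E (\<Union>\<U>)) (k + d) \<and>
        (\<forall>V \<in> \<U>. \<sigma> (\<Union>\<U>) V (k + d) s = t V k (\<sigma> U V k \<psi>))"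
    proof (rule gluing)
      fix V W assume V: "V \<in> \<U>" and W: "W \<in> \<U>"
      note oV = op[OF V] and oW = op[OF W]
      have oI: "openin M (V \<inter> W)" using oV oW by blast
      have \<psi>V: "\<sigma> U V k \<psi> \<in> gcarrier (E V) k" and \<psi>W: "\<sigma> U W k \<psi> \<in> gcarrier (E W) k"
        by (rule res_closed[OF U _ _ \<psi>]; fact oV oW sub[OF V] sub[OF W])+
      show "openin M V" by fact
      show "t V k (\<sigma> U V k \<psi>) \<in> gcarrier (E V) (k + d)" by (rule Loc_closed[OF t[OF V] \<psi>V])
      show "\<sigma> V (V \<inter> W) (k + d) (t V k (\<sigma> U V k \<psi>)) = \<sigma> W (V \<inter> W) (k + d) (t W k (\<sigma> U W k \<psi>))"
        using loc_res_apply[OF oV oI Int_lower1 t[OF V] \<psi>V] loc_res_apply[OF oW oI Int_lower2 t[OF W] \<psi>W]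
          compat[OF V W] res_comp[OF U oV oI Int_lower1 sub[OF V] \<psi>]
          res_comp[OF U oW oI Int_lower2 sub[OF W] \<psi>] by simp
    qed
    then show ?thesis unfolding U_def by blast
  qed
  then have "\<forall>k. \<forall>\<psi> \<in> gcarrier (E U) k. \<exists>s. s \<in> gcarrier (E U) (k + d) \<and>
      (\<forall>V \<in> \<U>. \<sigma> U V (k + d) s = t V k (\<sigma> U V k \<psi>))" by blast
  then obtain g where g: "\<forall>k. \<forall>\<psi> \<in> gcarrier (E U) k. g k \<psi> \<in> gcarrier (E U) (k + d) \<and>
      (\<forall>V \<in> \<U>. \<sigma> U V (k + d) (g k \<psi>) = t V k (\<sigma> U V k \<psi>))"
    unfolding bchoice_iff choice_iff by blast
  define F where "F k = restrict (g k) (gcarrier (E U) k)" for k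
  have closed: "F k \<psi> \<in> gcarrier (E U) (k + d)" if "\<psi> \<in> gcarrier (E U) k" for k \<psi>
    using g that by (simp add: F_def)
  have F_res: "\<sigma> U V (k + d) (F k \<psi>) = t V k (\<sigma> U V k \<psi>)"
    if "V \<in> \<U>" "\<psi> \<in> gcarrier (E U) k" for V k \<psi>
    using g that by (simp add: F_def)
  have F: "F \<in> gcarrier (L U) d"
  proof (rule LocI)
    show "F k \<in> extensional (gcarrier (E U) k)" for k by (simp add: F_def)
    fix k \<psi> assume \<psi>: "\<psi> \<in> gcarrier (E U) k"
    show "F k \<psi> \<in> gcarrier (E U) (k + d)" using \<psi> by (rule closed)
    show "F k (\<psi> \<oplus>\<^bsub>part (E U) k\<^esub> \<phi>) = F k \<psi> \<oplus>\<^bsub>part (E U) (k + d)\<^esub> F k \<phi>"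
      if \<phi>: "\<phi> \<in> gcarrier (E U) k" for \<phi>
    proof (rule eqI)
      fix V assume V: "V \<in> \<U>"
      note o = U op[OF V] sub[OF V]
      show "\<sigma> U V (k + d) (F k (\<psi> \<oplus>\<^bsub>part (E U) k\<^esub> \<phi>)) =
          \<sigma> U V (k + d) (F k \<psi> \<oplus>\<^bsub>part (E U) (k + d)\<^esub> F k \<phi>)"
        using \<psi> \<phi> by (simp add: F_res[OF V] EU.add_closed res_add[OF o] closed
            Loc_add[OF t[OF V]] res_closed[OF o])
    qed (intro closed EU.add_closed \<psi> \<phi>)+
    show "F k (c \<odot>\<^bsub>part (E U) k\<^esub> \<psi>) = c \<odot>\<^bsub>part (E U) (k + d)\<^esub> F k \<psi>" for c
    proof (rule eqI)
      fix V assume V: "V \<in> \<U>"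
      note o = U op[OF V] sub[OF V]
      show "\<sigma> U V (k + d) (F k (c \<odot>\<^bsub>part (E U) k\<^esub> \<psi>)) =
          \<sigma> U V (k + d) (c \<odot>\<^bsub>part (E U) (k + d)\<^esub> F k \<psi>)"
        using \<psi> by (simp add: F_res[OF V] EU.smult_closed res_smult[OF o] closed
            Loc_smult[OF t[OF V]] res_closed[OF o])
    qed (intro closed EU.smult_closed \<psi>)+
    show "\<sigma> U W (k + d) (F k \<psi>) = \<zero>\<^bsub>part (E W) (k + d)\<^esub>"
      if W: "openin M W" "W \<subseteq> U" "\<sigma> U W k \<psi> = \<zero>\<^bsub>part (E W) k\<^esub>" for W
    proof (rule sections_eqI[OF W(1) res_closed[OF U W(1,2) closed[OF \<psi>]] zero_section[OF W(1)]])
      fix x assume x: "x \<in> W"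
      then obtain V where V: "V \<in> \<U>" "x \<in> V" using W(2) by (auto simp: U_def)
      note oV = op[OF V(1)] and VU = sub[OF V(1)]
      define N where "N = V \<inter> W"
      have N: "openin M N" "x \<in> N" "N \<subseteq> V" "N \<subseteq> W" using oV W V x by (auto simp: N_def)
      have \<psi>V: "\<sigma> U V k \<psi> \<in> gcarrier (E V) k" by (rule res_closed[OF U oV VU \<psi>])
      have "\<sigma> V N k (\<sigma> U V k \<psi>) = \<sigma> W N k (\<sigma> U W k \<psi>)"
        using res_comp[OF U oV N(1,3) VU \<psi>] res_comp[OF U W(1) N(1,4) W(2) \<psi>] by simp
      then have "\<sigma> V N k (\<sigma> U V k \<psi>) = \<zero>\<^bsub>part (E N) k\<^esub>"
        using W(3) res_zero[OF W(1) N(1,4)] by simp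
      then have "\<sigma> V N (k + d) (t V k (\<sigma> U V k \<psi>)) = \<zero>\<^bsub>part (E N) (k + d)\<^esub>"
        by (rule LocD(3)[OF t[OF V(1)] \<psi>V N(1,3)])
      then have "\<sigma> W N (k + d) (\<sigma> U W (k + d) (F k \<psi>)) = \<sigma> W N (k + d) \<zero>\<^bsub>part (E W) (k + d)\<^esub>"
        using res_comp[OF U W(1) N(1,4) W(2) closed[OF \<psi>]] res_comp[OF U oV N(1,3) VU closed[OF \<psi>]]
          F_res[OF V(1) \<psi>] res_zero[OF W(1) N(1,4)] by simp
      with N show "\<exists>N. openin M N \<and> x \<in> N \<and> N \<subseteq> W \<and>
          \<sigma> W N (k + d) (\<sigma> U W (k + d) (F k \<psi>)) = \<sigma> W N (k + d) \<zero>\<^bsub>part (E W) (k + d)\<^esub>"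
        by blast
    qed
  qed
  have res_F: "r U V d F = t V" if V: "V \<in> \<U>" for V
    using F_res[OF V] by (intro loc_res_eqI U op sub V t) (simp add: is_restriction_def)
  have "F' = F" if F': "F' \<in> gcarrier (L U) d" "\<And>V. V \<in> \<U> \<Longrightarrow> r U V d F' = t V" for F'
  proof (rule Loc_eqI[OF F'(1) F])
    fix k \<psi> assume \<psi>: "\<psi> \<in> gcarrier (E U) k"
    show "F' k \<psi> = F k \<psi>"
    proof (rule eqI)
      show "\<sigma> U V (k + d) (F' k \<psi>) = \<sigma> U V (k + d) (F k \<psi>)" if V: "V \<in> \<U>" for V
        using loc_res_apply[OF U op[OF V] sub[OF V] F'(1) \<psi>] F'(2)[OF V] F_res[OF V \<psi>] by simp
    qed (intro Loc_closed[OF F'(1)] Loc_closed[OF F] \<psi>)+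
  qed
  with F res_F show ?thesis unfolding U_def by blast
qed

theorem Loc_sheaf: "sheaf_of_graded_modules M C \<rho> L r"
proof (intro sheaf_of_graded_modules.intro sheaf_of_graded_modules_axioms.intro graded_sheaf.intro)
  show "sheaf_of_graded_algebras M C \<rho>" by unfold_locales
qed (fact Loc_graded_vector_space loc_res_linear loc_res_id loc_res_comp Loc_gluing Loc_graded_module loc_res_gact)+

end

theorem proposition1p5:
  fixes n :: "int \<Rightarrow> nat"
    and M :: "'p topology"
    and C :: "'p set \<Rightarrow> 'c graded_alg"
    and \<rho> :: "'p set \<Rightarrow> 'p set \<Rightarrow> int \<Rightarrow> 'c \<Rightarrow> 'c"
    and K :: "'k graded_space"
    and E :: "'p set \<Rightarrow> ('c, 'e) graded_mod"
    and \<sigma> :: "'p set \<Rightarrow> 'p set \<Rightarrow> int \<Rightarrow> 'e \<Rightarrow> 'e"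
  assumes "graded_manifold n M C \<rho>"
    and "graded_vector_bundle M C \<rho> K E \<sigma>"
  shows
    "(\<forall>U V d. \<forall>F \<in> gcarrier (Loc M E \<sigma> U) d. openin M U \<and> openin M V \<and> V \<subseteq> U \<longrightarrow>
       (\<exists>!G. G \<in> gcarrier (Loc M E \<sigma> V) d \<and>
         (\<forall>k. \<forall>\<psi> \<in> gcarrier (E U) k. \<sigma> U V (k + d) (F k \<psi>) = G k (\<sigma> U V k \<psi>)))) \<and>
     (\<forall>U. openin M U \<longrightarrow>
       graded_module (C U) (Loc M E \<sigma> U) \<and>
       (\<forall>i d k. \<forall>f \<in> gcarrier (C U) i. \<forall>F \<in> gcarrier (Loc M E \<sigma> U) d. \<forall>\<psi> \<in> gcarrier (E U) k.
         gact (Loc M E \<sigma> U) i d f F k \<psi> = gact (E U) i (k + d) f (F k \<psi>))) \<and>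
     sheaf_of_graded_modules M C \<rho> (Loc M E \<sigma>) (loc_res M E \<sigma>)"
proof -
  interpret M: graded_manifold n M C \<rho> by fact
  interpret E: graded_vector_bundle M C \<rho> K E \<sigma> by fact
  interpret E: sheaf_of_graded_modules_with_bumps M C \<rho> E \<sigma>
  proof
    fix V x assume "openin M V" "x \<in> V"
    then show "\<exists>f A N. f \<in> gcarrier (C (topspace M)) 0 \<and> closedin M A \<and> A \<subseteq> V \<and>
      openin M N \<and> x \<in> N \<and> N \<subseteq> A \<and>
      \<rho> (topspace M) N 0 f = gone (C N) \<and>
      \<rho> (topspace M) (topspace M - A) 0 f = \<zero>\<^bsub>part (C (topspace M - A)) 0\<^esub>"
      by (rule M.bump_function) blast
  qed
  show ?thesis
  proof (intro conjI allI ballI impI)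
    fix U V d F assume F: "F \<in> gcarrier (Loc M E \<sigma> U) d" and "openin M U \<and> openin M V \<and> V \<subseteq> U"
    then have op: "openin M U" "openin M V" "V \<subseteq> U" by auto
    obtain G where "G \<in> gcarrier (Loc M E \<sigma> V) d" "E.is_restriction U V d F G"
      by (rule E.restriction_exists[OF op F])
    then show "\<exists>!G. G \<in> gcarrier (Loc M E \<sigma> V) d \<and>
         (\<forall>k. \<forall>\<psi> \<in> gcarrier (E U) k. \<sigma> U V (k + d) (F k \<psi>) = G k (\<sigma> U V k \<psi>))"
      using E.restriction_unique[OF op] unfolding E.is_restriction_def by blast
  qed (simp_all add: E.Loc_graded_module E.Loc_gact_apply E.Loc_sheaf)
qed

end
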